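(* Let $p$ be an odd prime and $q = 3^p$. Then $|\mathrm{Solv}(\mathrm{PSL}(2, q))| = \frac{4q^2 - q + 1}{2}$.
   Context: For a finite group $G$ and $x \in G$, the solvabilizer of $x$ in $G$ is $\mathrm{Sol}_G(x) = \{y \in G : \langle x, y \rangle \text{ is solvable}\}$. $\mathrm{Solv}(G) = \{\mathrm{Sol}_G(x) : x \in G\}$ is the set of distinct solvabilizers of elements of $G$, and $|\mathrm{Solv}(G)|$ is its cardinality. *)

theory Defs
  imports "HOL-Analysis.Analysis" "HOL-Algebra.Solvable_Groups" "HOL-Algebra.Coset"
begin

definition SL2 :: "('a::field ^ 2 ^ 2) monoid" where
  "SL2 = \<lparr> carrier = {A :: 'a ^ 2 ^ 2. det A = 1}, monoid.mult = (\<lambda>A B. A ** B), one = mat 1 \<rparr>"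

text \<open>The centre of SL(2,F), namely the scalar matrices of determinant one: {I, -I}.\<close>
definition SL2_centre :: "('a::field ^ 2 ^ 2) set" where
  "SL2_centre = {mat 1, - mat 1}"

definition PSL2 :: "('a::field ^ 2 ^ 2) set monoid" where
  "PSL2 = SL2 Mod SL2_centre"

definition Sol :: "('a, 'b) monoid_scheme \<Rightarrow> 'a \<Rightarrow> 'a set" where
  "Sol G x = {y \<in> carrier G. solvable (subgroup_generated G {x, y})}"

definition Solv :: "('a, 'b) monoid_scheme \<Rightarrow> 'a set set" where
  "Solv G = Sol G ` carrier G"

end

theory Submission
  imports Defs "HOL-Number_Theory.Residues"
begin

text \<open>Work with lifts to $\mathrm{SL}_2(q)$; here $3 = 0$ and, as $p$ is odd, $-1$ is not a square.
  If $\langle x, y \rangle$ is solvable in $\mathrm{PSL}_2(q)$, the last nontrivial term of its derived series is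
  abelian and normal. If the lift of this term is commutative, then $x$ and $y$ normalise the line spanned by
  some $v \neq 0$ of trace zero; otherwise it contains anticommuting $i, j$, and $x$ and $y$ permute the lines
  spanned by $i$, $j$ and $ij$. In the first case $\langle x, y \rangle$ is indeed solvable. In the second case
  $x$ is scalar, of trace zero or unipotent up to sign, so this case matters only for involutions and unipotents.

  Write $x = s + t v$ with $v$ of trace zero, scaled so that $\det v \in \{0, 1, -1\}$. Then the solvabilizer
  of $x$ depends only on $\pm v$ and, if $\det v = 1$, on whether $s = 0$ (an involution) or not. There are $1$,
  $q^2 - 1$, $q^2 - q$ and $q^2 + q$ matrices $v$ of trace zero that are zero, nonzero of determinant $0$, and of
  determinant $1$ and $-1$, so there are at most
  $1 + (q^2-1)/2 + 2 (q^2-q)/2 + (q^2+q)/2$ solvabilizers. They are distinct because they are told apart by the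
  nonsplit tori and the unipotents they contain: unipotents $1 + m$ and $1 + n$ generate a solvable group iff
  $\mathrm{tr}(mn)$ lies in the prime field.\<close>

section \<open>Solvable groups\<close>

text \<open>Two features of the field shape everything. Since \<open>2 = -1\<close> is not a square,
  a determinant-one matrix of trace zero has no eigenvector, so involutions lie in nonsplit tori
  only; and no nonscalar element of nonzero trace can fix one of the lines of \<open>i\<close>,
  \<open>j\<close>, \<open>ij\<close> while permuting them. Such elements therefore act on the three
  lines as 3-cycles, which in characteristic 3 are unipotent up to sign: tetrahedral subgroups are
  what makes the solvabilizer of a unipotent larger than a Borel subgroup. To recover a class from
  its solvabilizer, probes with a known solvabilizer are needed. For \<open>a + b i\<close> in a
  nonsplit torus, \<open>a\<close> and \<open>b\<close> nonzero, it is exactly the torus normaliser,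
  so membership becomes commuting up to sign with \<open>i\<close>. This invariant is empty for
  split and for noncentral unipotent elements; unipotent probes separate those. Probes and
  separation both rest on a field element outside the prime field: over the field of 3 elements the
  group is A4, and all solvabilizers coincide.\<close>

lemma (in group) solvable_seq_mono:
  assumes "solvable_seq G K" "subgroup H G" "H \<subseteq> K"
  shows "solvable_seq G H"
proof -
  obtain n where n: "(derived G ^^ n) K = {\<one>}"
    using solvable_imp_trivial_derived_seq[OF assms(1)] by blast
  have "(derived G ^^ n) H = {\<one>}"
    using mono_exp_of_derived[OF assms(3), of n] n
      subgroup.one_closed[OF exp_of_derived_is_subgroup[OF assms(2)], of n] by auto
  then show ?thesis
    by (rule trivial_derived_seq_imp_solvable[OF assms(2)])
qed

lemma (in group) solvable_seq_if_commutators: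
  assumes H: "subgroup H G" and K: "solvable_seq G K"
    and comm: "\<And>x y. x \<in> H \<Longrightarrow> y \<in> H \<Longrightarrow> x \<otimes> y \<otimes> inv x \<otimes> inv y \<in> K"
  shows "solvable_seq G H"
proof (rule augment_solvable_seq[OF H])
  have "derived G H \<subseteq> K"
    unfolding derived_def
    by (rule generate_subgroup_incl[OF _ solvable_imp_subgroup[OF K]]) (use comm in auto)
  then show "solvable_seq G (derived G H)"
    using solvable_seq_mono[OF K] derived_is_subgroup subgroup.subset[OF H] by blast
qed

lemma (in group) solvable_imp_abelian_normal:
  assumes "solvable G" "carrier G \<noteq> {\<one>}"
  obtains A where "A \<lhd> G" "A \<noteq> {\<one>}" "\<And>a b. a \<in> A \<Longrightarrow> b \<in> A \<Longrightarrow> a \<otimes> b = b \<otimes> a"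
proof -
  define D where "D n = (derived G ^^ n) (carrier G)" for n
  have normal: "D n \<lhd> G" for n
    unfolding D_def by (induction n) (simp_all add: normal_self derived_is_normal)
  obtain n where "D n = {\<one>}"
    using assms(1) by (auto simp: solvable_iff_trivial_derived_seq D_def)
  moreover have "D 0 \<noteq> {\<one>}"
    using assms(2) by (simp add: D_def)
  ultimately obtain m where least: "\<forall>i\<le>m. D i \<noteq> {\<one>}" and m2: "D (Suc m) = {\<one>}"
    using ex_least_nat_less[of "\<lambda>n. D n = {\<one>}"] by metis
  have m1: "D m \<noteq> {\<one>}"
    using least[rule_format, OF order_refl] .
  have comm: "a \<otimes> b = b \<otimes> a" if "a \<in> D m" "b \<in> D m" for a b
  proof -
    have c: "a \<in> carrier G" "b \<in> carrier G"
      using that subgroup.mem_carrier[OF normal_imp_subgroup[OF normal]] by simp_all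
    have "a \<otimes> b \<otimes> inv a \<otimes> inv b \<in> derived G (D m)"
      unfolding derived_def by (rule generate.incl) (use that in auto)
    then have "a \<otimes> b \<otimes> inv a \<otimes> inv b = \<one>"
      using m2 by (simp add: D_def)
    then show ?thesis
      using c by (simp add: inv_solve_right' inv_solve_right)
  qed
  show thesis
    using that[OF normal m1 comm] .
qed

text \<open>\<open>Sol\<close> speaks of the generated subgroup as a group of its own, while
  \<open>solvable_seq\<close> keeps it inside \<open>G\<close>, where monotonicity and images apply.
  The inclusion map transports solvability both ways.\<close>

lemma (in group) solvable_subgroup_generated_iff:
  assumes "S \<subseteq> carrier G"
  shows "solvable (subgroup_generated G S) \<longleftrightarrow> solvable_seq G (generate G S)"
proof -
  let ?H = "subgroup_generated G S"
  have car: "carrier ?H = generate G S"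
    using assms by (simp add: carrier_subgroup_generated Int_absorb1)
  interpret H: group_hom ?H G "\<lambda>x. x"
    using assms by (intro group_hom.intro group_hom_axioms.intro)
      (auto simp: hom_def car generate_in_carrier)
  show ?thesis
    using H.solvable_imp_solvable_img[of "generate G S"]
      H.solvable_img_imp_solvable[OF H.subgroup_self]
    by (auto simp: solvable_def car)
qed

lemma (in group) generate_pair_inv:
  assumes "x \<in> carrier G" "y \<in> carrier G"
  shows "generate G {inv x, y} = generate G {x, y}"
proof -
  have sub: "generate G {inv a, b} \<subseteq> generate G {a, b}" if "a \<in> carrier G" "b \<in> carrier G" for a b
    using that by (intro generate_subgroup_incl generate_is_subgroup)
      (auto intro: generate.incl generate.inv)
  from sub[of x y] sub[of "inv x" y] assms show ?thesis
    by auto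
qed

section \<open>Fields of order $3^p$\<close>

text \<open>Multiplication by \<open>x\<close> permutes the nonzero elements, hence fixes their
  nonzero product.\<close>

lemma finite_field_fermat:
  fixes x :: "'a::{field, finite}"
  assumes "x \<noteq> 0"
  shows "x ^ (CARD('a) - 1) = 1"
proof -
  let ?U = "UNIV - {0::'a}"
  have "bij_betw ((*) x) ?U ?U"
    using assms by (intro bij_betwI[where g = "\<lambda>y. y / x"]) auto
  then have "(\<Prod>y\<in>?U. x * y) = \<Prod>?U"
    by (rule prod.reindex_bij_betw)
  then have "x ^ card ?U * \<Prod>?U = \<Prod>?U"
    by (simp add: prod.distrib)
  then show ?thesis
    by (simp add: card_Diff_singleton)
qed

text \<open>This is what the group theory takes from \<open>q = 3^p\<close> with \<open>p\<close>
  odd: the second and third assumptions come from \<open>q mod 4 = 3\<close>, the fourth from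
  \<open>q > 3\<close>. The cardinality itself reappears only in the counting.\<close>

locale char3_field =
  fixes ty :: "'a::{field, finite} itself"
  assumes three: "(3::'a) = 0"
    and minus_one_nonsquare: "\<And>x::'a. x * x \<noteq> -1"
    and square_or_minus_square: "\<And>x::'a. \<exists>s. x = s * s \<or> x = - (s * s)"
    and beyond_prime_field: "\<exists>m::'a. m \<noteq> 0 \<and> m \<noteq> 1 \<and> m \<noteq> -1"

lemma three_power_odd_mod_4: "odd p \<Longrightarrow> (3::nat) ^ p mod 4 = 3"
proof (elim oddE)
  fix k assume "p = 2 * k + 1"
  moreover have "(9::nat) ^ k mod 4 = 1"
    by (induction k) (simp_all add: mod_mult_right_eq[symmetric] del: mod_mult_right_eq, presburger?)
  ultimately show ?thesis
    by (simp add: power_mult power_add) presburger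
qed

lemma char3_field_if_card:
  fixes p :: nat
  assumes p: "prime p" "odd p" and card: "CARD('a::{field, finite}) = 3 ^ p"
  shows "char3_field TYPE('a)"
proof
  have "of_nat (3 ^ p) = (0::'a)"
    using CHAR_dvd_CARD[where 'a='a] card by (simp add: of_nat_eq_0_iff_char_dvd del: of_nat_power)
  then show three: "(3::'a) = 0"
    by simp
  obtain k where k: "(3::nat) ^ p = 4 * k + 3"
    using three_power_odd_mod_4[OF p(2)] by (metis mult_div_mod_eq)
  \<comment> \<open>Half of \<open>q - 1\<close> is odd, so raising \<open>x * x = -1\<close> to
    that power would give \<open>-1 = 1\<close>.\<close>
  have half: "CARD('a) - 1 = 2 * (2 * k + 1)"
    using card k by simp
  have neq: "(-1::'a) \<noteq> 1"
  proof
    assume "(-1::'a) = 1"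
    then have "(2::'a) = 0"
      by (metis add.left_inverse add.commute one_add_one)
    moreover have "(3::'a) = 2 + 1"
      by simp
    ultimately show False
      using three by simp
  qed
  show "x * x \<noteq> -1" for x :: 'a
  proof
    assume x: "x * x = -1"
    then have "x \<noteq> 0"
      by auto
    then have "(x\<^sup>2) ^ (2 * k + 1) = 1"
      using finite_field_fermat[of x] unfolding half power_mult by blast
    then show False
      using x neq by (simp add: power2_eq_square)
  qed
  show "\<exists>s. x = s * s \<or> x = - (s * s)" for x :: 'a
  proof (cases "x = 0")
    case False
    \<comment> \<open>Euler's criterion: \<open>t\<close> is \<open>1\<close> or \<open>-1\<close>,
      and \<open>x * t\<close> is the square of \<open>x ^ (k + 1)\<close>.\<close>
    define t where "t = x ^ (2 * k + 1)"
    have "t * t = 1"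
      using finite_field_fermat[OF False] unfolding half t_def by (simp only: mult_2 power_add)
    then have "t = 1 \<or> t = -1"
      by (simp add: square_eq_1_iff)
    moreover have "x ^ (k + 1) * x ^ (k + 1) = x * t"
      unfolding t_def mult_2 power_add by (simp only: power_one_right mult_ac)
    ultimately show ?thesis
      by (metis minus_minus mult.right_neutral mult_minus_right)
  qed auto
  show "\<exists>m::'a. m \<noteq> 0 \<and> m \<noteq> 1 \<and> m \<noteq> -1"
  proof (rule ccontr)
    assume "\<not> ?thesis"
    then have "(UNIV :: 'a set) \<subseteq> {0, 1, -1}"
      by auto
    then have "CARD('a) \<le> card {0, 1, -1::'a}"
      by (intro card_mono) auto
    also have "\<dots> \<le> 3"
      by (simp add: card_insert_if)
    finally have "(3::nat) ^ p \<le> 3 ^ 1"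
      using card by simp
    then have "p \<le> 1"
      by (subst (asm) power_increasing_iff) auto
    then show False
      using prime_gt_1_nat[OF p(1)] by simp
  qed
qed

section \<open>Lifting from $\mathrm{PSL}_2$ to $\mathrm{SL}_2$\<close>

lemma matrix_mult_uminus_left: "(- A) ** B = - (A ** (B::'a::field^'n^'m))"
  by (simp add: matrix_matrix_mult_def vec_eq_iff sum_negf)

lemma matrix_mult_uminus_right: "A ** (- B) = - (A ** (B::'a::field^'n^'m))"
  by (simp add: matrix_matrix_mult_def vec_eq_iff sum_negf)

lemmas matrix_uminus = matrix_mult_uminus_left matrix_mult_uminus_right

lemma det_uminus_2: "det (- A :: 'a::field^2^2) = det A"
  by (simp add: det_2)

lemma carrier_SL2 [simp]: "carrier SL2 = {A :: 'a::field^2^2. det A = 1}"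
  and mult_SL2 [simp]: "mult SL2 = ((**) :: 'a^2^2 \<Rightarrow> _)"
  and one_SL2 [simp]: "one SL2 = (mat 1 :: 'a^2^2)"
  by (simp_all add: SL2_def)

lemma group_SL2: "group (SL2 :: ('a::field^2^2) monoid)"
proof (rule groupI)
  fix x :: "'a^2^2"
  assume x: "x \<in> carrier SL2"
  then obtain y where y: "x ** y = mat 1" "y ** x = mat 1"
    using invertible_det_nz[of x] by (auto simp: invertible_def)
  then have "det y = 1"
    using x det_mul[of x y] by simp
  with y show "\<exists>y\<in>carrier SL2. y \<otimes>\<^bsub>SL2\<^esub> x = \<one>\<^bsub>SL2\<^esub>"
    by auto
qed (auto simp: det_mul matrix_mul_assoc)

interpretation SL2: group "SL2 :: ('a::field^2^2) monoid"
  by (rule group_SL2)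

lemma SL2_centre_normal: "SL2_centre \<lhd> (SL2 :: ('a::field^2^2) monoid)"
proof -
  have "subgroup SL2_centre (SL2 :: ('a^2^2) monoid)"
  proof (rule SL2.subgroupI)
    fix a :: "'a^2^2" assume "a \<in> SL2_centre"
    moreover have "inv\<^bsub>SL2\<^esub> (- mat 1) = (- mat 1 :: 'a^2^2)"
      by (rule SL2.inv_equality) (auto simp: matrix_uminus det_uminus_2)
    ultimately show "inv\<^bsub>SL2\<^esub> a \<in> SL2_centre"
      using SL2.inv_one by (auto simp: SL2_centre_def)
  qed (auto simp: SL2_centre_def matrix_uminus det_uminus_2)
  moreover have "x \<otimes>\<^bsub>SL2\<^esub> h \<otimes>\<^bsub>SL2\<^esub> inv\<^bsub>SL2\<^esub> x \<in> SL2_centre"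
    if "x \<in> carrier SL2" "h \<in> SL2_centre" for x h :: "'a^2^2"
    using that SL2.r_inv[of x] by (auto simp: SL2_centre_def matrix_uminus)
  ultimately show ?thesis
    by (auto simp: SL2.normal_inv_iff)
qed

interpretation SL2_centre: normal SL2_centre "SL2 :: ('a::field^2^2) monoid"
  by (rule SL2_centre_normal)

interpretation PSL2: group "PSL2 :: ('a::field^2^2) set monoid"
  unfolding PSL2_def by (rule SL2_centre.factorgroup_is_group)

text \<open>The coset as an explicit doubleton, so that equality in the quotient is equality up to
  sign.\<close>

definition proj :: "'a::field^2^2 \<Rightarrow> ('a^2^2) set" where
  "proj x = {x, - x}"

lemma proj_eq_coset: "proj x = SL2_centre #>\<^bsub>SL2\<^esub> (x :: 'a::field^2^2)"
  by (auto simp: proj_def r_coset_def SL2_centre_def matrix_uminus)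

lemma proj_eq_iff: "proj x = proj y \<longleftrightarrow> x = y \<or> x = - y"
  by (auto simp: proj_def doubleton_eq_iff)

lemma carrier_PSL2: "carrier PSL2 = proj ` {A :: 'a::field^2^2. det A = 1}"
  by (simp add: PSL2_def carrier_FactGroup proj_eq_coset)

interpretation proj: group_hom "SL2 :: ('a::field^2^2) monoid" PSL2 proj
  using SL2_centre.r_coset_hom_Mod
  by unfold_locales (simp add: PSL2_def proj_eq_coset[abs_def])

definition sol :: "'a::field^2^2 \<Rightarrow> 'a^2^2 \<Rightarrow> bool" where
  "sol x y \<longleftrightarrow> solvable (subgroup_generated PSL2 {proj x, proj y})"

lemma sol_commute: "sol x y \<longleftrightarrow> sol y x"
  by (simp add: sol_def insert_commute)

lemma sol_uminus: "sol (- x) y \<longleftrightarrow> sol x y"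
  by (simp add: sol_def proj_def insert_commute)

lemma Sol_proj_eq_iff:
  fixes x x' :: "'a::field^2^2"
  shows "Sol PSL2 (proj x) = Sol PSL2 (proj x') \<longleftrightarrow> (\<forall>y. det y = 1 \<longrightarrow> (sol x y \<longleftrightarrow> sol x' y))"
  by (auto simp: Sol_def sol_def carrier_PSL2 set_eq_iff)

lemma Solv_PSL2: "Solv PSL2 = (\<lambda>x. Sol PSL2 (proj x)) ` {x :: 'a::field^2^2. det x = 1}"
  by (simp add: Solv_def carrier_PSL2 image_image)

lemma sol_iff_generate:
  fixes x y :: "'a::field^2^2"
  assumes "det x = 1" "det y = 1"
  shows "sol x y \<longleftrightarrow> solvable_seq PSL2 (generate PSL2 {proj x, proj y})"
  unfolding sol_def by (rule PSL2.solvable_subgroup_generated_iff) (use assms in \<open>auto simp: carrier_PSL2\<close>)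

lemma sol_inv:
  fixes x y z :: "'a::field^2^2"
  assumes "det x = 1" "det y = 1" "x ** z = mat 1"
  shows "sol z y \<longleftrightarrow> sol x y"
proof -
  have z: "det z = 1"
    using det_mul[of x z] assms by simp
  have "inv\<^bsub>SL2\<^esub> z = x"
    by (rule SL2.inv_equality) (use assms z in auto)
  then have "proj x = inv\<^bsub>PSL2\<^esub> (proj z)"
    using proj.hom_inv[of z] z by simp
  then show ?thesis
    using PSL2.generate_pair_inv[of "proj z" "proj y"] assms z
    unfolding sol_iff_generate[OF assms(1,2)] sol_iff_generate[OF z assms(2)] carrier_PSL2
    by simp
qed

lemma sol_if_solvable_subgroup:
  fixes x y :: "'a::field^2^2"
  assumes K: "solvable_seq SL2 K" and xy: "x \<in> K" "y \<in> K"
  shows "sol x y"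
proof -
  have "det x = 1" "det y = 1"
    using xy subgroup.mem_carrier[OF SL2.solvable_imp_subgroup[OF K]] by auto
  then have "{proj x, proj y} \<subseteq> carrier PSL2"
    by (auto simp: carrier_PSL2)
  then have gen: "subgroup (generate PSL2 {proj x, proj y}) PSL2"
    by (rule PSL2.generate_is_subgroup)
  have K': "solvable_seq PSL2 (proj ` K)"
    by (rule proj.solvable_imp_solvable_img[OF K])
  have "generate PSL2 {proj x, proj y} \<subseteq> proj ` K"
    by (rule PSL2.generate_subgroup_incl[OF _ PSL2.solvable_imp_subgroup[OF K']]) (use xy in blast)
  from PSL2.solvable_seq_mono[OF K' gen this] show ?thesis
    by (simp only: sol_iff_generate[OF \<open>det x = 1\<close> \<open>det y = 1\<close>])
qed

text \<open>\<open>A\<close> is the full preimage of an abelian normal subgroup \<open>B\<close> of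
  the generated group. Commuting in the quotient lifts to commuting up to sign, and invariance under
  conjugation by \<open>g\<close> is written \<open>g a = b g\<close> to avoid inverses.\<close>

lemma sol_obtains_normal:
  fixes x y :: "'a::field^2^2"
  assumes det: "det x = 1" "det y = 1" and sol: "sol x y"
    and nontriv: "\<not> (x \<in> SL2_centre \<and> y \<in> SL2_centre)"
  obtains A where "\<And>a. a \<in> A \<Longrightarrow> det a = 1" "\<not> A \<subseteq> SL2_centre"
    "\<And>a b. a \<in> A \<Longrightarrow> b \<in> A \<Longrightarrow> a ** b = b ** a \<or> a ** b = - (b ** a)"
    "\<And>a g. a \<in> A \<Longrightarrow> g \<in> {x, y} \<Longrightarrow> \<exists>b\<in>A. g ** a = b ** g"
proof -
  let ?H = "subgroup_generated PSL2 {proj x, proj y}"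
  interpret H: group ?H
    by simp
  have "{proj x, proj y} \<subseteq> carrier PSL2"
    using det by (auto simp: carrier_PSL2)
  from PSL2.subgroup_generated_subset_carrier_subset[OF this]
  have car: "proj x \<in> carrier ?H" "proj y \<in> carrier ?H"
    by blast+
  have one: "proj a = \<one>\<^bsub>PSL2\<^esub> \<longleftrightarrow> a \<in> SL2_centre" for a :: "'a^2^2"
    unfolding proj.hom_one[symmetric] one_SL2 proj_eq_iff SL2_centre_def by simp
  have "carrier ?H \<noteq> {\<one>\<^bsub>?H\<^esub>}"
    using car nontriv one by auto
  then obtain B where B: "B \<lhd> ?H" "B \<noteq> {\<one>\<^bsub>?H\<^esub>}"
      and comm: "\<And>a b. a \<in> B \<Longrightarrow> b \<in> B \<Longrightarrow> a \<otimes>\<^bsub>?H\<^esub> b = b \<otimes>\<^bsub>?H\<^esub> a"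
    using H.solvable_imp_abelian_normal sol unfolding sol_def by metis
  interpret B: normal B ?H
    by (rule B(1))
  have BH: "B \<subseteq> carrier PSL2"
    using B.subset PSL2.carrier_subgroup_generated_subset by blast
  let ?A = "{a. det a = 1 \<and> proj a \<in> B}"
  show thesis
  proof (rule that[of ?A])
    show "det a = 1" if "a \<in> ?A" for a
      using that by blast
  next
    show "\<not> ?A \<subseteq> SL2_centre"
    proof
      assume A: "?A \<subseteq> SL2_centre"
      have "b = \<one>\<^bsub>PSL2\<^esub>" if b: "b \<in> B" for b
      proof -
        obtain a where "b = proj a" "det a = 1"
          using b BH by (auto simp: carrier_PSL2)
        then show ?thesis
          using A b one by auto
      qed
      moreover have "\<one>\<^bsub>PSL2\<^esub> \<in> B"
        using B.one_closed by (simp only: one_subgroup_generated)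
      ultimately have "B = {\<one>\<^bsub>PSL2\<^esub>}"
        by blast
      then show False
        using B(2) by (simp only: one_subgroup_generated)
    qed
  next
    fix a b assume "a \<in> ?A" "b \<in> ?A"
    then have "proj (a ** b) = proj (b ** a)"
      using comm[of "proj a" "proj b"] proj.hom_mult[of a b] proj.hom_mult[of b a] by simp
    then show "a ** b = b ** a \<or> a ** b = - (b ** a)"
      by (simp add: proj_eq_iff)
  next
    fix a g assume a: "a \<in> ?A" and g: "g \<in> {x, y}"
    let ?b = "g ** a ** inv\<^bsub>SL2\<^esub> g"
    have gS: "g \<in> carrier SL2" "proj g \<in> carrier ?H"
      using g det car by auto
    have inv: "inv\<^bsub>SL2\<^esub> g \<in> carrier SL2"
      using gS(1) by (rule SL2.inv_closed)
    have "inv\<^bsub>?H\<^esub> (proj g) = proj (inv\<^bsub>SL2\<^esub> g)"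
      unfolding PSL2.inv_subgroup_generated[OF gS(2)] using proj.hom_inv[OF gS(1)] by (rule sym)
    moreover have "proj ?b = proj g \<otimes>\<^bsub>PSL2\<^esub> proj a \<otimes>\<^bsub>PSL2\<^esub> proj (inv\<^bsub>SL2\<^esub> g)"
      using proj.hom_mult[of "g ** a", OF _ inv] proj.hom_mult[OF gS(1), of a] gS(1) a by (simp add: det_mul)
    ultimately have b: "proj ?b = proj g \<otimes>\<^bsub>?H\<^esub> proj a \<otimes>\<^bsub>?H\<^esub> inv\<^bsub>?H\<^esub> (proj g)"
      by (simp only: mult_subgroup_generated)
    have "proj ?b \<in> B"
      unfolding b using B.inv_op_closed2[OF gS(2)] a by blast
    moreover have "det ?b = 1"
      using a gS inv by (simp add: det_mul)
    moreover have "?b ** g = g ** a"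
      using SL2.l_inv[OF gS(1)] by (simp add: matrix_mul_assoc[symmetric])
    ultimately show "\<exists>b\<in>?A. g ** a = b ** g"
      by (intro bexI[of _ ?b]) simp_all
  qed
qed

section \<open>Centralisers and normalisers of traceless matrices\<close>

text \<open>Naming the four entries turns matrix identities into polynomial ones, open to Groebner
  bases.\<close>

definition mat2 :: "'a \<Rightarrow> 'a \<Rightarrow> 'a \<Rightarrow> 'a \<Rightarrow> 'a::field^2^2" where
  "mat2 a b c d = (\<chi> i j. if i = 1 then (if j = 1 then a else b) else (if j = 1 then c else d))"

definition smult :: "'a \<Rightarrow> 'a^2^2 \<Rightarrow> 'a::field^2^2" (infixr \<open>*m\<close> 75) where
  "l *m A = (\<chi> i j. l * A $ i $ j)"

abbreviation sl :: "'a \<Rightarrow> 'a \<Rightarrow> 'a \<Rightarrow> 'a::field^2^2" where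
  "sl p q r \<equiv> mat2 p q r (- p)"

lemma mat2_nth [simp]:
  "mat2 a b c d $ 1 $ 1 = a" "mat2 a b c d $ 1 $ 2 = b"
  "mat2 a b c d $ 2 $ 1 = c" "mat2 a b c d $ 2 $ 2 = d"
  by (simp_all add: mat2_def)

lemma matrix_2_eq_iff:
  "A = B \<longleftrightarrow> A$1$1 = B$1$1 \<and> A$1$2 = B$1$2 \<and> A$2$1 = B$2$1 \<and> A$2$2 = B$2$2"
  for A B :: "'a^2^2"
  by (auto simp: vec_eq_iff forall_2)

lemma mat2_eq_iff [simp]:
  "mat2 a b c d = mat2 a' b' c' d' \<longleftrightarrow> a = a' \<and> b = b' \<and> c = c' \<and> d = d'"
  by (simp add: matrix_2_eq_iff)

lemma mat2_cases:
  obtains a b c d where "A = mat2 a b c d"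
proof
  show "A = mat2 (A$1$1) (A$1$2) (A$2$1) (A$2$2)"
    by (simp add: matrix_2_eq_iff)
qed

lemma mat2_simps:
  "mat2 a b c d ** mat2 a' b' c' d' = mat2 (a*a'+b*c') (a*b'+b*d') (c*a'+d*c') (c*b'+d*d')"
  "l *m mat2 a b c d = mat2 (l*a) (l*b) (l*c) (l*d)"
  "mat2 a b c d + mat2 a' b' c' d' = mat2 (a+a') (b+b') (c+c') (d+d')"
  "mat2 a b c d - mat2 a' b' c' d' = mat2 (a-a') (b-b') (c-c') (d-d')"
  "- mat2 a b c d = mat2 (-a) (-b) (-c) (-d)"
  "mat e = mat2 e 0 0 e"
  "0 = mat2 0 0 0 0"
  "det (mat2 a b c d) = a*d - b*c"
  "trace (mat2 a b c d) = a + d"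
  by (simp_all add: matrix_2_eq_iff matrix_matrix_mult_def sum_2 smult_def mat_def det_2 trace_def)

lemma smult_simps [simp]:
  "(l *m A) ** B = l *m (A ** B)"
  "A ** (l *m B) = l *m (A ** B)"
  "l *m (k *m A) = (l * k) *m A"
  "1 *m A = A" "(-1) *m A = - A" "0 *m A = 0"
  "det (l *m A) = l * l * det A"
  "trace (l *m A) = l * trace A"
  "- (l *m A) = (- l) *m A"
  "l *m (- A) = (- l) *m A"
  by (cases A rule: mat2_cases; cases B rule: mat2_cases; simp add: mat2_simps algebra_simps)+

lemma smult_cancel:
  assumes "l \<noteq> 0" "l *m A = l *m B"
  shows "A = B"
  using assms by (cases A rule: mat2_cases; cases B rule: mat2_cases; simp add: mat2_simps)

lemma traceless_cases:
  assumes "trace v = 0"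
  obtains p q r where "v = sl p q r"
  using assms by (cases v rule: mat2_cases) (auto simp: mat2_simps add_eq_0_iff intro: that)

lemma SL2_ex_inverse:
  fixes x :: "'a::field^2^2"
  assumes "det x = 1"
  obtains z where "det z = 1" "x ** z = mat 1" "z ** x = mat 1"
proof -
  obtain a b c d where x: "x = mat2 a b c d"
    by (rule mat2_cases)
  show thesis
    by (rule that[of "mat2 d (-b) (-c) a"]; use assms x in \<open>simp add: mat2_simps algebra_simps\<close>)
qed

lemma SL2_cancel_right:
  fixes x :: "'a::field^2^2"
  assumes "det x = 1" "A ** x = B ** x"
  shows "A = B"
  by (metis SL2_ex_inverse[OF assms(1)] assms(2) matrix_mul_assoc matrix_mul_rid)

lemma SL2_cancel_left:
  fixes x :: "'a::field^2^2"
  assumes "det x = 1" "x ** A = x ** B"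
  shows "A = B"
  by (metis SL2_ex_inverse[OF assms(1)] assms(2) matrix_mul_assoc matrix_mul_lid)

text \<open>The equations say that the 2 by 2 minors of the rows \<open>(p, q, r)\<close> and
  \<open>(t, b, c)\<close> vanish, so the second row is a multiple of the nonzero first one.\<close>

lemma parallel_triples:
  fixes p q r t b c :: "'a::field"
  assumes "p \<noteq> 0 \<or> q \<noteq> 0 \<or> r \<noteq> 0" "p * b = q * t" "p * c = r * t" "q * c = r * b"
  obtains k where "t = k * p" "b = k * q" "c = k * r"
proof -
  consider "p \<noteq> 0" | "q \<noteq> 0" | "r \<noteq> 0"
    using assms(1) by blast
  then show thesis
  proof cases
    case 1
    show thesis
      by (rule that[of "t / p"]) (use 1 assms in \<open>auto simp: field_simps\<close>)
  next
    case 2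
    show thesis
      by (rule that[of "b / q"]) (use 2 assms in \<open>auto simp: field_simps\<close>)
  next
    case 3
    show thesis
      by (rule that[of "c / r"]) (use 3 assms in \<open>auto simp: field_simps\<close>)
  qed
qed

text \<open>For invertible \<open>x\<close> this says that conjugation by \<open>x\<close> sends the
  line of \<open>v\<close> onto the line of \<open>w\<close>.\<close>

definition carries :: "'a::field^2^2 \<Rightarrow> 'a^2^2 \<Rightarrow> 'a^2^2 \<Rightarrow> bool" where
  "carries x v w \<longleftrightarrow> (\<exists>l. l \<noteq> 0 \<and> x ** v = l *m (w ** x))"

text \<open>For $v \neq 0$ of trace zero, the elements of $\mathrm{SL}_2$ that normalise $v$ form
  the normaliser of a torus if $\det v \neq 0$, and a Borel subgroup if $\det v = 0$.\<close>

abbreviation normalises :: "'a::field^2^2 \<Rightarrow> 'a^2^2 \<Rightarrow> bool" where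
  "normalises x v \<equiv> carries x v v"

context char3_field
begin

lemma two: "(2::'a) = -1"
proof -
  have "(2::'a) + 1 = 0"
    using three by simp
  then show ?thesis
    by (simp only: eq_neg_iff_add_eq_0)
qed

lemma double: "x + x = - x" for x :: 'a
  using two by (metis mult_2 mult_minus1)

lemma double_eq_0_iff: "x + x = 0 \<longleftrightarrow> x = 0" for x :: 'a
  by (simp add: double)

lemma minus_eq_self_iff: "- x = x \<longleftrightarrow> x = 0" for x :: 'a
  by (metis double double_eq_0_iff add.inverse_inverse add_eq_0_iff)

lemma minus_one_neq_one: "(-1::'a) \<noteq> 1"
  using minus_eq_self_iff[of 1] by simp

lemma two_neq_0: "(2::'a) \<noteq> 0"
  by (simp add: two)

lemma matrix_minus_eq_self: "- A = A \<longleftrightarrow> A = 0" for A :: "'a^2^2"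
  by (cases A rule: mat2_cases) (simp add: mat2_simps minus_eq_self_iff)

text \<open>Up to sign, the entries of \<open>x v - v x\<close> are the minors of
  \<open>(p, q, r)\<close> and \<open>(d - a, b, c)\<close>. The latter is the traceless part of
  \<open>x\<close>, which must therefore be a multiple of \<open>v\<close>.\<close>

lemma commute_iff:
  fixes v x :: "'a^2^2"
  assumes "v \<noteq> 0" "trace v = 0"
  shows "x ** v = v ** x \<longleftrightarrow> (\<exists>a b. x = mat a + b *m v)"
proof
  obtain p q r where v: "v = sl p q r"
    using assms(2) by (rule traceless_cases)
  obtain a b c d where x: "x = mat2 a b c d"
    by (rule mat2_cases)
  {
    assume "x ** v = v ** x"
    then have e: "a * p + b * r = p * a + q * c" "a * q + b * (- p) = p * b + q * d"
        "c * p + d * r = r * a + - p * c"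
      by (simp_all only: x v mat2_simps mat2_eq_iff)
    have "q * c = r * b"
      using e(1) by Groebner_Basis.algebra
    moreover have "q * (d - a) = - (p * b + p * b)"
      using e(2) by Groebner_Basis.algebra
    then have "p * b = q * (d - a)"
      by (simp add: double)
    moreover have "r * (d - a) = - (p * c + p * c)"
      using e(3) by Groebner_Basis.algebra
    then have "p * c = r * (d - a)"
      by (simp add: double)
    moreover have "p \<noteq> 0 \<or> q \<noteq> 0 \<or> r \<noteq> 0"
      using assms by (auto simp: v mat2_simps)
    ultimately obtain k where "d - a = k * p" "b = k * q" "c = k * r"
      using parallel_triples[of p q r b "d - a" c] by metis
    \<comment> \<open>The scalar part of \<open>x\<close> is half its trace, and one half is
      \<open>-1\<close> in characteristic 3.\<close>
    moreover have "a = - (a + d) + (d - a)" "d = - (a + d) - (d - a)"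
      using double[of a] double[of d] by (simp_all add: algebra_simps)
    ultimately have "x = mat (- (a + d)) + k *m v"
      by (simp add: x v mat2_simps)
    then show "\<exists>a b. x = mat a + b *m v"
      by blast
  }
  show "x ** v = v ** x" if "\<exists>a b. x = mat a + b *m v"
    using that by (auto simp: v mat2_simps ring_distribs mult_ac)
qed

text \<open>Polarised Cayley-Hamilton for traceless \<open>v\<close>:
  \<open>x v + v x = tr(x v) + tr(x) v\<close>. As \<open>v\<close> is not scalar, both coefficients
  must vanish.\<close>

lemma anticommute_iff:
  fixes v x :: "'a^2^2"
  assumes "v \<noteq> 0" "trace v = 0"
  shows "x ** v = - (v ** x) \<longleftrightarrow> trace x = 0 \<and> trace (x ** v) = 0"
proof -
  obtain p q r where v: "v = sl p q r"
    using assms(2) by (rule traceless_cases)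
  obtain a b c d where x: "x = mat2 a b c d"
    by (rule mat2_cases)
  have nz: "p \<noteq> 0 \<or> q \<noteq> 0 \<or> r \<noteq> 0"
    using assms by (auto simp: v mat2_simps)
  have *: "x ** v + v ** x = mat2 (trace (x ** v) + (a + d) * p) ((a + d) * q) ((a + d) * r) (trace (x ** v) - (a + d) * p)"
    by (simp add: x v mat2_simps algebra_simps)
  have "x ** v = - (v ** x) \<longleftrightarrow> x ** v + v ** x = 0"
    by (rule eq_neg_iff_add_eq_0)
  also have "\<dots> \<longleftrightarrow> a + d = 0 \<and> trace (x ** v) = 0"
    using nz two_neq_0 unfolding * by (auto simp: mat2_simps)
  finally show ?thesis
    by (simp add: x mat2_simps)
qed

text \<open>Taking determinants in \<open>x v = l v x\<close> gives
  \<open>l * l = 1\<close>.\<close>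

lemma normalises_nonsingular:
  fixes v x :: "'a^2^2"
  assumes "normalises x v" "det v \<noteq> 0" "det x = 1"
  shows "x ** v = v ** x \<or> x ** v = - (v ** x)"
proof -
  obtain l where l: "x ** v = l *m (v ** x)"
    using assms(1) by (auto simp: carries_def)
  have "det v = l * l * det v"
    using arg_cong[OF l, of det] assms(3) by (simp add: det_mul)
  then have "l = 1 \<or> l = -1"
    using assms(2) by (simp add: square_eq_1_iff)
  with l show ?thesis
    by auto
qed

text \<open>A nilpotent \<open>v\<close> has rank one, so \<open>v x v = tr(x v) v\<close>; but
  \<open>x v = l v x\<close> and \<open>v v = 0\<close> give \<open>v x v = 0\<close>.\<close>

lemma normalises_nilpotent_imp:
  fixes v x :: "'a^2^2"
  assumes "normalises x v" "v \<noteq> 0" "trace v = 0" "det v = 0"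
  shows "trace (x ** v) = 0"
proof -
  obtain p q r where v: "v = sl p q r"
    using assms(3) by (rule traceless_cases)
  obtain a b c d where x: "x = mat2 a b c d"
    by (rule mat2_cases)
  obtain l where l: "x ** v = l *m (v ** x)"
    using assms(1) by (auto simp: carries_def)
  have pqr: "p * p + q * r = 0"
    using assms(4) by (simp add: v mat2_simps algebra_simps add_eq_0_iff)
  have "v ** v = 0"
    using pqr by (simp add: v mat2_simps algebra_simps)
  moreover have "v ** (x ** v) = trace (x ** v) *m v"
    using pqr by (simp add: x v mat2_simps) Groebner_Basis.algebra
  moreover have "v ** (x ** v) = l *m ((v ** v) ** x)"
    unfolding l by (simp add: matrix_mul_assoc)
  ultimately have "trace (x ** v) *m v = 0"
    by (simp add: matrix_matrix_mult_def vec_eq_iff smult_def)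
  then show ?thesis
    using assms(2) by (auto simp: v mat2_simps)
qed

text \<open>The matrix is the column \<open>(s, t)\<close> times the row \<open>(t, - s)\<close>, so
  its kernel and image are both spanned by \<open>(s, t)\<close>: nilpotents are points of the
  projective line with a scale.\<close>

lemma nilpotent_cases:
  fixes v :: "'a^2^2"
  assumes "v \<noteq> 0" "trace v = 0" "det v = 0"
  obtains k s t where "k \<noteq> 0" "s \<noteq> 0 \<or> t \<noteq> 0" "v = k *m sl (s * t) (- s * s) (t * t)"
proof -
  obtain p q r where v: "v = sl p q r"
    using assms(2) by (rule traceless_cases)
  have pqr: "p * p + q * r = 0"
    using assms(3) by (simp add: v mat2_simps algebra_simps add_eq_0_iff)
  show thesis
  proof (cases "q = 0")
    case True
    then have "p = 0" "r \<noteq> 0"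
      using pqr assms(1) by (auto simp: v mat2_simps)
    then show thesis
      using that[of r 0 1] True by (simp add: v mat2_simps)
  next
    case False
    then show thesis
      using that[of "- q" 1 "- p / q"] pqr by (simp add: v mat2_simps field_simps add_eq_0_iff2)
  qed
qed

text \<open>With \<open>(s, t)\<close> spanning the kernel of \<open>v\<close>, trace zero says that
  \<open>(s, t)\<close> is an eigenvector of \<open>x\<close>. If \<open>m\<close> is its eigenvalue
  and \<open>m' = tr(x) - m\<close> the other one, then \<open>m * m' = 1\<close>,
  \<open>x v = m v\<close> and \<open>v x = m' v\<close>.\<close>

lemma normalises_nilpotent_if:
  fixes v x :: "'a^2^2"
  assumes "v \<noteq> 0" "trace v = 0" "det v = 0" "trace (x ** v) = 0" "det x = 1"
  shows "normalises x v"
proof -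
  obtain k s t where k: "k \<noteq> 0" and st: "s \<noteq> 0 \<or> t \<noteq> 0" and v: "v = k *m sl (s * t) (- s * s) (t * t)"
    using assms(1-3) by (rule nilpotent_cases)
  obtain a b c d where x: "x = mat2 a b c d"
    by (rule mat2_cases)
  have det: "a * d - b * c = 1"
    using assms(5) by (simp add: x mat2_simps)
  have tr: "a * s * t + b * t * t - c * s * s - d * t * s = 0"
    using assms(4) k by (simp add: x v mat2_simps algebra_simps) Groebner_Basis.algebra
  have "\<exists>m. a * s + b * t = m * s \<and> c * s + d * t = m * t"
  proof (cases "s = 0")
    case True
    then show ?thesis
      using st tr by (intro exI[of _ d]) auto
  next
    case False
    show ?thesis
    proof (intro exI conjI)
      show "a * s + b * t = (a + b * t / s) * s"
        using False by (simp add: field_simps)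
      have "s * (c * s + d * t) = a * s * t + b * t * t"
        using tr by Groebner_Basis.algebra
      then show "c * s + d * t = (a + b * t / s) * t"
        using False by (simp add: field_simps)
    qed
  qed
  then obtain m where m: "a * s + b * t = m * s" "c * s + d * t = m * t"
    by blast
  obtain m' where m': "m' = a + d - m"
    by blast
  have mm: "m * m' = 1"
    using st
  proof
    assume "s \<noteq> 0"
    moreover have "s * (m * m') = s"
      using m det unfolding m' by Groebner_Basis.algebra
    ultimately show ?thesis
      by simp
  next
    assume "t \<noteq> 0"
    moreover have "t * (m * m') = t"
      using m det unfolding m' by Groebner_Basis.algebra
    ultimately show ?thesis
      by simp
  qed
  have "x ** v = m *m v"
    using m by (simp add: x v mat2_simps) Groebner_Basis.algebra
  moreover have "v ** x = m' *m v"
    using m by (simp add: x v mat2_simps m') Groebner_Basis.algebra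
  ultimately have "x ** v = (m * m) *m (v ** x)"
    using mm by (simp add: mult.assoc)
  moreover have "m * m \<noteq> 0"
    using mm by auto
  ultimately show ?thesis
    unfolding carries_def by blast
qed

text \<open>The trace is a nonzero multiple of the squared determinant of the two kernel vectors, so
  it vanishes only if these are proportional.\<close>

lemma nilpotent_orthogonal:
  fixes m n :: "'a^2^2"
  assumes m: "m \<noteq> 0" "trace m = 0" "det m = 0" and n: "n \<noteq> 0" "trace n = 0" "det n = 0"
    and "trace (m ** n) = 0"
  obtains k where "k \<noteq> 0" "n = k *m m"
proof -
  obtain k s t where k: "k \<noteq> 0" "s \<noteq> 0 \<or> t \<noteq> 0" and m': "m = k *m sl (s * t) (- s * s) (t * t)"
    using m by (rule nilpotent_cases)
  obtain k' s' t' where k': "k' \<noteq> 0" "s' \<noteq> 0 \<or> t' \<noteq> 0" and n': "n = k' *m sl (s' * t') (- s' * s') (t' * t')"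
    using n by (rule nilpotent_cases)
  have "trace (m ** n) = - (k * k' * ((s * t' - s' * t) * (s * t' - s' * t)))"
    by (simp add: m' n' mat2_simps) Groebner_Basis.algebra
  then have "s * t' = s' * t"
    using assms(7) k(1) k'(1) by simp
  moreover obtain c where "s' = c * s" "t' = c * t"
  proof (cases "s = 0")
    case True
    then show thesis
      using that[of "t' / t"] k(2) calculation by auto
  next
    case False
    then show thesis
      using that[of "s' / s"] calculation by (auto simp: field_simps)
  qed
  ultimately have "n = (k' * c * c / k) *m m" "c \<noteq> 0"
    using k k' by (auto simp: m' n' mat2_simps)
  then show thesis
    using that[of "k' * c * c / k"] k(1) k'(1) by simp
qed

text \<open>Otherwise the kernel vector of \<open>v\<close> would be an eigenvector of
  \<open>i\<close>, with a square root of \<open>-1\<close> as eigenvalue.\<close>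

lemma involution_not_orthogonal_to_nilpotent:
  fixes i v :: "'a^2^2"
  assumes i: "trace i = 0" "det i = 1" and v: "v \<noteq> 0" "trace v = 0" "det v = 0"
  shows "trace (i ** v) \<noteq> 0"
proof
  assume tr: "trace (i ** v) = 0"
  obtain k s t where k: "k \<noteq> 0" and st: "s \<noteq> 0 \<or> t \<noteq> 0" and v': "v = k *m sl (s * t) (- s * s) (t * t)"
    using v by (rule nilpotent_cases)
  obtain p q r where i': "i = sl p q r"
    using i(1) by (rule traceless_cases)
  have det: "p * p + q * r = -1"
    using i(2) by (simp add: i' mat2_simps) Groebner_Basis.algebra
  have "k * (2 * p * s * t + q * t * t - r * s * s) = 0"
    using tr by (simp add: i' v' mat2_simps) Groebner_Basis.algebra
  then have *: "2 * p * s * t + q * t * t - r * s * s = 0"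
    using k by simp
  show False
  proof (cases "s = 0")
    case True
    then have "p * p = -1"
      using * st det by simp
    then show False
      using minus_one_nonsquare by blast
  next
    case False
    have "(p * s + q * t) * (p * s + q * t) = - (s * s)"
      using * det by Groebner_Basis.algebra
    then have "((p * s + q * t) / s) * ((p * s + q * t) / s) = -1"
      using False by (simp add: field_simps)
    then show False
      using minus_one_nonsquare by blast
  qed
qed

end

section \<open>Conjugation action on lines and the solvable subgroups it yields\<close>

lemma carries_one: "carries (mat 1) v v"
  unfolding carries_def by (rule exI[of _ 1]) simp

lemma carries_mult:
  fixes x y :: "'a::field^2^2"
  assumes "carries x v w" "carries y u v"
  shows "carries (x ** y) u w"
proof -
  obtain l k where lk: "l \<noteq> 0" "k \<noteq> 0" "x ** v = l *m (w ** x)" "y ** u = k *m (v ** y)"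
    using assms by (auto simp: carries_def)
  have "x ** y ** u = k *m ((x ** v) ** y)"
    using lk(4) by (simp add: matrix_mul_assoc[symmetric])
  also have "\<dots> = (k * l) *m (w ** (x ** y))"
    unfolding lk(3) by (simp add: matrix_mul_assoc)
  finally show ?thesis
    unfolding carries_def using lk(1,2) by (intro exI[of _ "k * l"]) simp
qed

lemma carries_inverse:
  fixes x z :: "'a::field^2^2"
  assumes "carries x v w" "x ** z = mat 1" "z ** x = mat 1"
  shows "carries z w v"
proof -
  obtain l where l: "l \<noteq> 0" "x ** v = l *m (w ** x)"
    using assms(1) by (auto simp: carries_def)
  have "v ** z = z ** (x ** v) ** z"
    using assms(3) by (simp add: matrix_mul_assoc)
  also have "\<dots> = l *m (z ** w)"
    unfolding l(2) using assms(2) by (simp add: matrix_mul_assoc[symmetric])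
  finally have "z ** w = inverse l *m (v ** z)"
    using l(1) by simp
  then show ?thesis
    unfolding carries_def using l(1) by (intro exI[of _ "inverse l"]) simp
qed

lemma carries_cancel:
  fixes x y :: "'a::field^2^2"
  assumes "carries (x ** y) u w" "carries y u v" "det y = 1"
  shows "carries x v w"
proof -
  obtain z where z: "y ** z = mat 1" "z ** y = mat 1"
    using SL2_ex_inverse[OF assms(3)] by blast
  have "carries (x ** y ** z) v w"
    by (rule carries_mult[OF assms(1) carries_inverse[OF assms(2) z]])
  then show ?thesis
    using z(1) by (simp add: matrix_mul_assoc[symmetric])
qed

lemma SL2_inverse:
  fixes x :: "'a::field^2^2"
  assumes "det x = 1"
  shows "det (inv\<^bsub>SL2\<^esub> x) = 1" "x ** inv\<^bsub>SL2\<^esub> x = mat 1" "inv\<^bsub>SL2\<^esub> x ** x = mat 1"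
  using assms SL2.inv_closed[of x] SL2.r_inv[of x] SL2.l_inv[of x] by simp_all

text \<open>The equation \<open>k (y x) = x y\<close> pins down the commutator without
  inverses.\<close>

lemma SL2_commutator:
  fixes x y :: "'a::field^2^2"
  assumes "det x = 1" "det y = 1"
    and k: "k = x \<otimes>\<^bsub>SL2\<^esub> y \<otimes>\<^bsub>SL2\<^esub> inv\<^bsub>SL2\<^esub> x \<otimes>\<^bsub>SL2\<^esub> inv\<^bsub>SL2\<^esub> y"
  shows "det k = 1" "k ** (y ** x) = x ** y"
proof -
  show "det k = 1"
    using SL2_inverse(1)[OF assms(1)] SL2_inverse(1)[OF assms(2)] assms by (simp add: det_mul)
  have "k ** (y ** x) = x ** y ** inv\<^bsub>SL2\<^esub> x ** (inv\<^bsub>SL2\<^esub> y ** y) ** x"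
    by (simp add: k matrix_mul_assoc)
  also have "\<dots> = x ** y"
    using SL2_inverse[OF assms(1)] SL2_inverse[OF assms(2)] by (simp add: matrix_mul_assoc[symmetric])
  finally show "k ** (y ** x) = x ** y" .
qed

lemma subgroup_SL2I:
  fixes K :: "('a::field^2^2) set"
  assumes "\<And>x. x \<in> K \<Longrightarrow> det x = 1" "mat 1 \<in> K"
    "\<And>x y. x \<in> K \<Longrightarrow> y \<in> K \<Longrightarrow> x ** y \<in> K"
    "\<And>x z. x \<in> K \<Longrightarrow> det z = 1 \<Longrightarrow> x ** z = mat 1 \<Longrightarrow> z ** x = mat 1 \<Longrightarrow> z \<in> K"
  shows "subgroup K SL2"
proof (rule SL2.subgroupI)
  show "inv\<^bsub>SL2\<^esub> x \<in> K" if "x \<in> K" for x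
    using assms(4)[OF that] SL2_inverse[OF assms(1)[OF that]] by blast
  show "x \<otimes>\<^bsub>SL2\<^esub> y \<in> K" if "x \<in> K" "y \<in> K" for x y
    using assms(3)[OF that] by simp
qed (use assms(1,2) in \<open>simp_all add: subset_iff, blast\<close>)

context char3_field
begin

lemma centraliser_commute:
  fixes v x y :: "'a^2^2"
  assumes "v \<noteq> 0" "trace v = 0" "x ** v = v ** x" "y ** v = v ** y"
  shows "x ** y = y ** x"
proof -
  obtain a b c d where "x = mat a + b *m v" "y = mat c + d *m v"
    using assms commute_iff by metis
  then show ?thesis
    by (cases v rule: mat2_cases) (simp add: mat2_simps ring_distribs mult_ac)
qed

text \<open>The scalar $\lambda$ in $x v = \lambda v x$ depends multiplicatively on $x$, so commutators centralise $v$;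
  and the centraliser of $v$ is abelian.\<close>

lemma solvable_normaliser:
  fixes v :: "'a^2^2"
  assumes v: "v \<noteq> 0" "trace v = 0"
  shows "solvable_seq SL2 {x. det x = 1 \<and> normalises x v}"
proof -
  let ?N = "{x. det x = 1 \<and> normalises x v}" and ?C = "{x. det x = 1 \<and> x ** v = v ** x}"
  have C: "subgroup ?C SL2"
  proof (rule subgroup_SL2I)
    fix x y assume xy: "x \<in> ?C" "y \<in> ?C"
    have "x ** y ** v = x ** (v ** y)"
      using xy by (simp add: matrix_mul_assoc[symmetric])
    also have "\<dots> = v ** (x ** y)"
      using xy by (simp add: matrix_mul_assoc)
    finally show "x ** y \<in> ?C"
      using xy by (simp add: det_mul)
  next
    fix x z assume x: "x \<in> ?C" and z: "det z = 1" "x ** z = mat 1" "z ** x = mat 1"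
    have "z ** v = z ** (v ** x) ** z"
      using z by (simp add: matrix_mul_assoc[symmetric])
    also have "\<dots> = z ** (x ** v) ** z"
      using x by simp
    also have "\<dots> = v ** z"
      using z by (simp add: matrix_mul_assoc)
    finally show "z \<in> ?C"
      using z by simp
  qed auto
  have solv_C: "solvable_seq SL2 ?C"
  proof (rule SL2.solvable_seq_if_commutators[OF C solvable_seq.unity])
    fix x y assume xy: "x \<in> ?C" "y \<in> ?C"
    define k where k: "k = x \<otimes>\<^bsub>SL2\<^esub> y \<otimes>\<^bsub>SL2\<^esub> inv\<^bsub>SL2\<^esub> x \<otimes>\<^bsub>SL2\<^esub> inv\<^bsub>SL2\<^esub> y"
    have det: "det x = 1" "det y = 1"
      using xy by auto
    have "x ** y = y ** x"
      using centraliser_commute[OF v] xy by auto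
    then have "k ** (y ** x) = mat 1 ** (y ** x)"
      using SL2_commutator(2)[OF det k] by simp
    moreover have "det (y ** x) = 1"
      using det by (simp add: det_mul)
    ultimately have "k = mat 1"
      using SL2_cancel_right by blast
    then show "x \<otimes>\<^bsub>SL2\<^esub> y \<otimes>\<^bsub>SL2\<^esub> inv\<^bsub>SL2\<^esub> x \<otimes>\<^bsub>SL2\<^esub> inv\<^bsub>SL2\<^esub> y \<in> {\<one>\<^bsub>SL2\<^esub>}"
      unfolding k by simp
  qed
  have N: "subgroup ?N SL2"
    by (rule subgroup_SL2I) (use carries_one carries_mult carries_inverse in \<open>simp_all add: det_mul, blast+\<close>)
  show ?thesis
  proof (rule SL2.solvable_seq_if_commutators[OF N solv_C])
    fix x y assume xy: "x \<in> ?N" "y \<in> ?N"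
    define k where k: "k = x \<otimes>\<^bsub>SL2\<^esub> y \<otimes>\<^bsub>SL2\<^esub> inv\<^bsub>SL2\<^esub> x \<otimes>\<^bsub>SL2\<^esub> inv\<^bsub>SL2\<^esub> y"
    have det: "det x = 1" "det y = 1"
      using xy by auto
    note kk = SL2_commutator[OF det k]
    obtain l m where l: "l \<noteq> 0" "x ** v = l *m (v ** x)" and m: "m \<noteq> 0" "y ** v = m *m (v ** y)"
      using xy by (auto simp: carries_def)
    have mult: "a ** b ** v = (c * d) *m (v ** (a ** b))"
      if "a ** v = c *m (v ** a)" "b ** v = d *m (v ** b)" for a b :: "'a^2^2" and c d
    proof -
      have "a ** b ** v = d *m ((a ** v) ** b)"
        using that(2) by (simp add: matrix_mul_assoc[symmetric])
      then show ?thesis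
        unfolding that(1) by (simp add: matrix_mul_assoc mult.commute)
    qed
    have yx: "y ** x ** v = (l * m) *m (v ** (y ** x))"
      using mult[OF m(2) l(2)] by (simp only: mult.commute)
    have xy: "x ** y ** v = (l * m) *m (v ** (x ** y))"
      by (rule mult[OF l(2) m(2)])
    have "(l * m) *m (k ** v ** (y ** x)) = k ** (y ** x ** v)"
      unfolding yx by (simp add: matrix_mul_assoc)
    also have "\<dots> = x ** y ** v"
      by (simp only: matrix_mul_assoc kk(2)[unfolded matrix_mul_assoc])
    also have "\<dots> = (l * m) *m (v ** k ** (y ** x))"
      unfolding xy by (simp only: kk(2)[symmetric] matrix_mul_assoc)
    finally have "k ** v ** (y ** x) = v ** k ** (y ** x)"
      by (rule smult_cancel[rotated]) (use l(1) m(1) in simp)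
    moreover have "det (y ** x) = 1"
      using det by (simp add: det_mul)
    ultimately have "k ** v = v ** k"
      using SL2_cancel_right by blast
    then show "x \<otimes>\<^bsub>SL2\<^esub> y \<otimes>\<^bsub>SL2\<^esub> inv\<^bsub>SL2\<^esub> x \<otimes>\<^bsub>SL2\<^esub> inv\<^bsub>SL2\<^esub> y \<in> ?C"
      using kk(1) unfolding k by simp
  qed
qed

lemma sol_if_normalises:
  fixes v x y :: "'a^2^2"
  assumes "v \<noteq> 0" "trace v = 0" "det x = 1" "det y = 1" "normalises x v" "normalises y v"
  shows "sol x y"
  using sol_if_solvable_subgroup[OF solvable_normaliser[OF assms(1,2)]] assms by blast

text \<open>The matrices acting on the three lines by powers of one 3-cycle form a group
  \<open>?K\<close>, in which \<open>x\<close> rotates forwards and \<open>y\<close> backwards.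
  Rotations commute, so commutators fix the line of \<open>u\<close> and lie in its solvable
  normaliser.\<close>

lemma sol_if_cyclic:
  fixes u v w x y :: "'a^2^2"
  assumes nz: "u \<noteq> 0" "trace u = 0" and det: "det x = 1" "det y = 1"
    and x: "carries x u v" "carries x v w" "carries x w u"
    and y: "carries y u w" "carries y w v" "carries y v u"
  shows "sol x y"
proof -
  \<comment> \<open>Extending the three lines periodically makes a rotation a shift of the index by
    some \<open>e\<close>.\<close>
  define f where "f n = (if n mod 3 = 0 then u else if n mod 3 = 1 then v else w)" for n :: nat
  have period: "f (n + 3 * k) = f n" for n k
    by (simp add: f_def)
  let ?K = "{x. det x = 1 \<and> (\<exists>e. \<forall>n. carries x (f n) (f (n + e)))}"
  have "subgroup ?K SL2"
  proof (rule subgroup_SL2I)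
    show "mat 1 \<in> ?K"
      using carries_one by (auto intro!: exI[of _ 0])
  next
    fix x y assume "x \<in> ?K" "y \<in> ?K"
    then obtain e e' where e: "det x = 1" "det y = 1" "\<And>n. carries x (f n) (f (n + e))"
        "\<And>n. carries y (f n) (f (n + e'))"
      by blast
    have "carries (x ** y) (f n) (f (n + (e' + e)))" for n
      using carries_mult[OF e(3)[of "n + e'"] e(4)[of n]] by (simp add: add.assoc)
    then show "x ** y \<in> ?K"
      using e(1,2) by (auto simp: det_mul)
  next
    fix x z assume "x \<in> ?K" and z: "det z = 1" "x ** z = mat 1" "z ** x = mat 1"
    then obtain e where e: "\<And>n. carries x (f n) (f (n + e))"
      by blast
    \<comment> \<open>By period 3, the shift by \<open>2 * e\<close> undoes the shift by
      \<open>e\<close>.\<close>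
    have "carries z (f n) (f (n + 2 * e))" for n
      using carries_inverse[OF e[of "n + 2 * e"] z(2,3)] period[of n e] by (simp add: algebra_simps)
    then show "z \<in> ?K"
      using z(1) by blast
  qed auto
  then have solv: "solvable_seq SL2 ?K"
  proof (rule SL2.solvable_seq_if_commutators[OF _ solvable_normaliser[OF nz]])
    fix x y assume "x \<in> ?K" "y \<in> ?K"
    then obtain e e' where e: "det x = 1" "det y = 1" "\<And>n. carries x (f n) (f (n + e))"
        "\<And>n. carries y (f n) (f (n + e'))"
      by blast
    define k where k: "k = x \<otimes>\<^bsub>SL2\<^esub> y \<otimes>\<^bsub>SL2\<^esub> inv\<^bsub>SL2\<^esub> x \<otimes>\<^bsub>SL2\<^esub> inv\<^bsub>SL2\<^esub> y"
    note kk = SL2_commutator[OF e(1,2) k]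
    \<comment> \<open>Chosen so that a further shift by \<open>e + e'\<close> reaches a multiple of
      3, the index of \<open>u\<close>.\<close>
    let ?n = "2 * (e + e')"
    have 0: "f (?n + e + e') = u" "f (?n + e' + e) = u"
      using period[of 0 "e + e'"] by (simp_all add: f_def algebra_simps)
    have "carries (k ** (y ** x)) (f ?n) u"
      unfolding kk(2) using carries_mult[OF e(3)[of "?n + e'"] e(4)[of ?n]] by (simp only: 0)
    moreover have "carries (y ** x) (f ?n) u"
      using carries_mult[OF e(4)[of "?n + e"] e(3)[of ?n]] by (simp only: 0)
    ultimately have "normalises k u"
      by (rule carries_cancel) (use e in \<open>simp add: det_mul\<close>)
    then show "x \<otimes>\<^bsub>SL2\<^esub> y \<otimes>\<^bsub>SL2\<^esub> inv\<^bsub>SL2\<^esub> x \<otimes>\<^bsub>SL2\<^esub> inv\<^bsub>SL2\<^esub> y \<in> {x. det x = 1 \<and> normalises x u}"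
      using kk(1) unfolding k by simp
  qed
  have mod3: "n mod 3 = 0 \<or> n mod 3 = 1 \<or> n mod 3 = 2" for n :: nat
    by linarith
  have "carries x (f n) (f (n + 1))" for n
    using mod3[of n] x by (elim disjE) (simp_all add: f_def mod_Suc)
  then have xK: "x \<in> ?K"
    using det by blast
  have "carries y (f n) (f (n + 2))" for n
    using mod3[of n] y by (elim disjE) (simp_all add: f_def mod_Suc)
  then have yK: "y \<in> ?K"
    using det by blast
  show ?thesis
    by (rule sol_if_solvable_subgroup[OF solv xK yK])
qed

end

section \<open>Quaternion bases\<close>

lemma carries_prod:
  fixes x :: "'a::field^2^2"
  assumes "carries x u v" "carries x u' v'"
  shows "carries x (u ** u') (v ** v')"
proof -
  obtain l k where lk: "l \<noteq> 0" "k \<noteq> 0" "x ** u = l *m (v ** x)" "x ** u' = k *m (v' ** x)"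
    using assms by (auto simp: carries_def)
  have "x ** (u ** u') = l *m (v ** (x ** u'))"
    using lk(3) by (simp add: matrix_mul_assoc)
  also have "\<dots> = (l * k) *m (v ** v' ** x)"
    unfolding lk(4) by (simp add: matrix_mul_assoc)
  finally show ?thesis
    unfolding carries_def using lk(1,2) by (intro exI[of _ "l * k"]) simp
qed

lemma carries_uminus_right: "carries x u (- w) \<longleftrightarrow> carries x u (w :: 'a::field^2^2)"
proof -
  have "carries x u (- w)" if "carries x u w" for w :: "'a^2^2"
    using that unfolding carries_def
    by (elim exE) (rule_tac x = "- l" in exI, simp add: matrix_uminus)
  from this[of w] this[of "- w"] show ?thesis
    by auto
qed

lemma carries_same_imp_proportional:
  fixes x :: "'a::field^2^2"
  assumes "carries x u w" "carries x v w" "det x = 1"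
  obtains l where "v = l *m u"
proof -
  obtain l k where lk: "l \<noteq> 0" "x ** u = l *m (w ** x)" "x ** v = k *m (w ** x)"
    using assms(1,2) by (auto simp: carries_def)
  have "x ** v = x ** ((k / l) *m u)"
    using lk by simp
  then show thesis
    using that SL2_cancel_left[OF assms(3)] by blast
qed

lemma matrix_add_rdistrib: "(A + B) ** C = A ** C + B ** C"
  for A B C :: "'a::field^2^2"
  by (cases A rule: mat2_cases; cases B rule: mat2_cases; cases C rule: mat2_cases)
    (simp add: mat2_simps algebra_simps)

lemma smult_add: "l *m (A + B) = l *m A + l *m B"
  by (cases A rule: mat2_cases; cases B rule: mat2_cases) (simp add: mat2_simps algebra_simps)

lemma smult_mat_1: "l *m mat 1 = (mat l :: 'a::field^2^2)"
  by (simp add: mat2_simps)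

lemma smult_eq_0_iff: "l *m A = 0 \<longleftrightarrow> l = 0 \<or> A = (0 :: 'a::field^2^2)"
  by (cases A rule: mat2_cases) (auto simp: mat2_simps)

lemma traceless_square:
  fixes i :: "'a::field^2^2"
  assumes "trace i = 0"
  shows "i ** i = - det i *m mat 1"
proof -
  obtain p q r where "i = sl p q r"
    using assms by (rule traceless_cases)
  then show ?thesis
    by (simp add: mat2_simps algebra_simps)
qed

context char3_field
begin

text \<open>Such \<open>i\<close> and \<open>j\<close> have trace zero and square \<open>-1\<close>;
  they generate a quaternion group of order 8, whose image in \<open>PSL2\<close> is a Klein
  four-group.\<close>

definition quat :: "'a^2^2 \<Rightarrow> 'a^2^2 \<Rightarrow> bool" where
  "quat i j \<longleftrightarrow> det i = 1 \<and> det j = 1 \<and> i ** j = - (j ** i)"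

text \<open>Only \<open>i\<close> and \<open>j\<close> are asked about, since
  \<open>carries_prod\<close> then determines where the third line goes.\<close>

definition permutes_lines :: "'a^2^2 \<Rightarrow> 'a^2^2 \<Rightarrow> 'a^2^2 \<Rightarrow> bool" where
  "permutes_lines x i j \<longleftrightarrow> (\<forall>u\<in>{i, j}. carries x u i \<or> carries x u j \<or> carries x u (i ** j))"

lemma SL2_nonzero: "det x = 1 \<Longrightarrow> x \<noteq> 0" for x :: "'a^2^2"
  by (auto simp: mat2_simps)

text \<open>Conjugation by \<open>j\<close> turns \<open>i\<close> into \<open>- i\<close>, so the
  trace of \<open>i\<close> equals its own negative.\<close>

lemma trace_zero_if_anticommute:
  fixes i j :: "'a^2^2"
  assumes "det j = 1" "i ** j = - (j ** i)"
  shows "trace i = 0"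
proof -
  obtain z where z: "j ** z = mat 1" "z ** j = mat 1"
    using SL2_ex_inverse[OF assms(1)] by blast
  have "i = (i ** j) ** z"
    using z(1) by (simp add: matrix_mul_assoc[symmetric])
  then have "trace i = - trace (j ** i ** z)"
    unfolding assms(2) by (cases "j ** i ** z" rule: mat2_cases) (simp add: matrix_uminus mat2_simps)
  also have "trace (j ** i ** z) = trace (z ** j ** i)"
    using trace_mul_sym[of "j ** i" z] by (simp add: matrix_mul_assoc)
  finally show ?thesis
    using z(2) minus_eq_self_iff by simp
qed

context
  fixes i j :: "'a^2^2"
  assumes quat: "quat i j"
begin

lemma quat_det: "det i = 1" "det j = 1" "det (i ** j) = 1"
  and quat_anticommute: "i ** j = - (j ** i)" "j ** i = - (i ** j)"
proof -
  show "det i = 1" "det j = 1" "i ** j = - (j ** i)" "j ** i = - (i ** j)"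
    using quat by (simp_all add: quat_def)
  then show "det (i ** j) = 1"
    by (simp add: det_mul det_uminus_2)
qed

lemma quat_swap: "quat j i"
  unfolding quat_def by (intro conjI quat_det quat_anticommute)

lemma quat_trace: "trace i = 0" "trace j = 0"
  using trace_zero_if_anticommute[OF quat_det(2) quat_anticommute(1)]
    trace_zero_if_anticommute[OF quat_det(1) quat_anticommute(2)] .

lemma quat_square: "i ** i = - mat 1" "j ** j = - mat 1"
  using traceless_square[OF quat_trace(1)] traceless_square[OF quat_trace(2)] quat_det by simp_all

lemma quat_mult: "i ** j ** i = j" "j ** (i ** j) = i" "i ** (i ** j) = - j" "i ** j ** j = - i"
proof -
  show "i ** (i ** j) = - j"
    by (simp add: matrix_mul_assoc quat_square matrix_uminus)
  then show "i ** j ** i = j"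
    unfolding matrix_mul_assoc[symmetric] quat_anticommute(2) by (simp add: matrix_uminus)
  show "i ** j ** j = - i"
    by (simp add: matrix_mul_assoc[symmetric] quat_square matrix_uminus)
  then show "j ** (i ** j) = i"
    unfolding matrix_mul_assoc quat_anticommute(2) by (simp add: matrix_uminus)
qed

lemma quat_rotate: "quat (i ** j) i"
  unfolding quat_def quat_mult by (simp add: quat_det)

lemma trace_quat_mult: "trace (i ** j) = 0"
  using trace_zero_if_anticommute[OF quat_det(1), of "i ** j"] quat_mult(1,3) by simp

lemma quat_not_commute: "i ** j \<noteq> j ** i"
  using quat_anticommute(2) SL2_nonzero[OF quat_det(3)] matrix_minus_eq_self[of "i ** j"] by metis

lemma quat_not_proportional: "j \<noteq> l *m i"
  using quat_not_commute by auto

text \<open>Commuting with \<open>i\<close> means \<open>c = a + b i\<close>; comparing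
  \<open>c j\<close> with \<open>j c\<close> then kills \<open>b\<close> in the commuting case and
  \<open>a\<close> in the anticommuting one.\<close>

lemma fixes_lines_aux:
  assumes c: "c ** i = i ** c" and c': "c ** j = j ** c \<or> c ** j = - (j ** c)"
  shows "\<exists>l. c = l *m mat 1 \<or> c = l *m i"
proof -
  obtain a b where ab: "c = a *m mat 1 + b *m i"
    using c commute_iff[OF SL2_nonzero[OF quat_det(1)] quat_trace(1)]
    by (auto simp: smult_mat_1)
  have cj: "c ** j = a *m j + b *m (i ** j)"
    unfolding ab by (simp add: matrix_add_rdistrib)
  have jc: "j ** c = a *m j - b *m (i ** j)"
    unfolding ab by (simp add: smult_add matrix_add_ldistrib quat_anticommute(2))
  show ?thesis
    using c'
  proof
    assume "c ** j = j ** c"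
    then have "(b + b) *m (i ** j) = 0"
      unfolding cj jc by (cases "i ** j" rule: mat2_cases; cases j rule: mat2_cases)
        (auto simp: mat2_simps algebra_simps eq_neg_iff_add_eq_0)
    then have "b = 0"
      using SL2_nonzero[OF quat_det(3)] by (simp only: smult_eq_0_iff double_eq_0_iff simp_thms)
    then show ?thesis
      using ab by auto
  next
    assume "c ** j = - (j ** c)"
    then have "(a + a) *m j = 0"
      unfolding cj jc by (cases "i ** j" rule: mat2_cases; cases j rule: mat2_cases)
        (auto simp: mat2_simps algebra_simps eq_neg_iff_add_eq_0)
    then have "a = 0"
      using SL2_nonzero[OF quat_det(2)] by (simp only: smult_eq_0_iff double_eq_0_iff simp_thms)
    then show ?thesis
      using ab by auto
  qed
qed

text \<open>If \<open>c\<close> anticommutes with \<open>i\<close>, then \<open>j c\<close> commutes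
  with it, so \<open>fixes_lines_aux\<close> applies to \<open>j c\<close>.\<close>

lemma fixes_lines:
  assumes c: "c ** i = i ** c \<or> c ** i = - (i ** c)" and c': "c ** j = j ** c \<or> c ** j = - (j ** c)"
  shows "\<exists>l. \<exists>w\<in>{mat 1, i, j, i ** j}. c = l *m w"
  using c
proof
  assume "c ** i = i ** c"
  then show ?thesis
    using fixes_lines_aux[OF _ c'] by auto
next
  assume ci: "c ** i = - (i ** c)"
  have "j ** c ** i = i ** (j ** c)"
    unfolding matrix_mul_assoc[symmetric] ci
    by (simp add: matrix_mul_assoc matrix_uminus quat_anticommute(1))
  moreover have "j ** c ** j = j ** (j ** c) \<or> j ** c ** j = - (j ** (j ** c))"
    using c' by (auto simp: matrix_mul_assoc[symmetric] matrix_uminus)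
  ultimately obtain l where l: "j ** c = l *m mat 1 \<or> j ** c = l *m i"
    using fixes_lines_aux[of "j ** c"] by blast
  have "c = - (j ** (j ** c))"
    by (simp add: matrix_mul_assoc quat_square matrix_uminus)
  then have "c = (- l) *m j \<or> c = l *m (i ** j)"
    using l by (auto simp: quat_anticommute(2))
  then show ?thesis
    by auto
qed

lemma normalises_both:
  assumes "det c = 1" "normalises c i" "normalises c j"
  shows "(\<exists>l. c = mat l) \<or> trace c = 0"
proof -
  have "c ** i = i ** c \<or> c ** i = - (i ** c)" "c ** j = j ** c \<or> c ** j = - (j ** c)"
    using normalises_nonsingular assms quat_det by simp_all
  from fixes_lines[OF this] obtain l w where w: "w \<in> {mat 1, i, j, i ** j}" "c = l *m w"
    by blast
  then show ?thesis
    using quat_trace trace_quat_mult by (auto simp: mat2_simps)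
qed

text \<open>Nonzero trace rules out anticommuting, so \<open>x = a + b i\<close>. If
  \<open>x\<close> moved \<open>j\<close> to the line of \<open>i j\<close>, it would have order 4
  modulo the centre: determinants and traces force \<open>a = l b\<close> with
  \<open>l * l = 1\<close>, and then \<open>a * a + b * b = 1\<close> becomes
  \<open>b * b = -1\<close>.\<close>

lemma not_fixes_line:
  assumes x: "det x = 1" "trace x \<noteq> 0" "\<And>s. x \<noteq> mat s"
    and i: "normalises x i" and j: "carries x j i \<or> carries x j j \<or> carries x j (i ** j)"
  shows False
proof -
  have anti: "x ** v \<noteq> - (v ** x)" if "det v = 1" for v
    using trace_zero_if_anticommute[of v x] that x(2) by blast
  have xi: "x ** i = i ** x"
    using normalises_nonsingular[OF i] anti x quat_det by auto
  obtain a b where ab: "x = a *m mat 1 + b *m i"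
    using xi commute_iff[OF SL2_nonzero[OF quat_det(1)] quat_trace(1)]
    by (auto simp: smult_mat_1)
  from j show False
  proof (elim disjE)
    assume "carries x j i"
    then obtain l where "j = l *m i"
      using carries_same_imp_proportional[OF i _ x(1)] by blast
    then show False
      using quat_not_proportional by blast
  next
    assume "normalises x j"
    then show False
      using normalises_both[OF x(1) i] x by blast
  next
    assume "carries x j (i ** j)"
    then obtain l where l: "x ** j = l *m (i ** j ** x)"
      by (auto simp: carries_def)
    have "det (x ** j) = l * l * det (i ** j ** x)"
      unfolding l by simp
    then have ll: "l * l = 1"
      using x(1) quat_det by (simp add: det_mul)
    \<comment> \<open>Multiplying \<open>x j = l i j x\<close> by \<open>j\<close> on the right
      gives a second expression for \<open>x\<close>, whose trace is compared with that of
      \<open>a + b i\<close>.\<close>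
    have "- x = x ** j ** j"
      by (simp add: matrix_mul_assoc[symmetric] quat_square matrix_uminus)
    also have "\<dots> = l *m (a *m (i ** j ** j) + b *m (i ** j ** i ** j))"
      unfolding l by (subst ab) (simp add: matrix_mul_assoc smult_add matrix_add_ldistrib matrix_add_rdistrib)
    finally have "- x = l *m (a *m (- i) + b *m (- mat 1))"
      by (simp only: quat_mult quat_square)
    then have "trace (- x) = trace (l *m (a *m (- i) + b *m (- mat 1)))"
      by simp
    moreover obtain p q r where i_eq: "i = sl p q r"
      using quat_trace(1) by (rule traceless_cases)
    ultimately have "- (a + b * p) - (a - b * p) = l * (- (a * p) - b) + l * (a * p - b)"
      by (simp only: ab i_eq mat2_simps) Groebner_Basis.algebra
    then have "(a - l * b) + (a - l * b) = 0"
      by Groebner_Basis.algebra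
    then have "a = l * b"
      by (simp only: double_eq_0_iff right_minus_eq)
    moreover have "a * a + b * b = 1"
      using x(1) quat_det(1) by (simp add: ab i_eq mat2_simps) Groebner_Basis.algebra
    ultimately have "b * b + b * b = 1"
      using ll by Groebner_Basis.algebra
    then have "b * b = -1"
      by (simp only: double minus_equation_iff[of _ 1])
    then show False
      using minus_one_nonsquare by blast
  qed
qed

text \<open>Since $i$, $\pm j$ and $\pm ij$ are permuted cyclically by $x$, a suitable sum $v$ of them is centralised
  by $x$, and $v^2 = -3 = 0$.\<close>

lemma cycle_imp_nilpotent:
  assumes x: "det x = 1" and xi: "carries x i j" and xj: "carries x j (i ** j)"
  shows "\<exists>a n. x = mat a + n \<and> trace n = 0 \<and> det n = 0"
proof -
  obtain l m where l: "x ** i = l *m (j ** x)" and m: "x ** j = m *m (i ** j ** x)"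
    using xi xj by (auto simp: carries_def)
  have "det (x ** i) = l * l * det (j ** x)" "det (x ** j) = m * m * det (i ** j ** x)"
    unfolding l m by simp_all
  then have ll: "l * l = 1" and mm: "m * m = 1"
    using x quat_det by (simp_all add: det_mul)
  have "x ** (i ** j) = l *m (j ** (x ** j))"
    unfolding matrix_mul_assoc l by (simp add: matrix_mul_assoc)
  also have "\<dots> = (l * m) *m (i ** x)"
    unfolding m using quat_mult(2) by (simp add: matrix_mul_assoc)
  finally have k: "x ** (i ** j) = (l * m) *m (i ** x)" .
  have lm: "l * m * (l * m) = 1"
    using ll mm by Groebner_Basis.algebra
  \<comment> \<open>With these coefficients, conjugation by \<open>x\<close> sends each summand to
    the next and, as \<open>l * m\<close> has square \<open>1\<close>, the last to the
    first.\<close>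
  define v where "v = i + (l *m j + (l * m) *m (i ** j))"
  have "x ** v = v ** x"
    unfolding v_def by (simp add: smult_add matrix_add_ldistrib matrix_add_rdistrib l m k lm)
  moreover have tr: "trace v = 0"
    unfolding v_def by (simp add: trace_add quat_trace trace_quat_mult)
  moreover have sq: "(i ** j) ** (i ** j) = - mat 1"
    using quat_mult(1) quat_square(2) by (simp add: matrix_mul_assoc)
  have "v ** v = 0"
  proof -
    have "i ** v = - mat 1 + (l *m (i ** j) + (l * m) *m (- j))"
      unfolding v_def by (simp add: smult_add matrix_add_ldistrib quat_square quat_mult)
    moreover have "j ** v = - (i ** j) + (l *m (- mat 1) + (l * m) *m i)"
      unfolding v_def by (simp add: smult_add matrix_add_ldistrib quat_square quat_mult quat_anticommute(2))
    moreover have "i ** j ** v = j + (l *m (- i) + (l * m) *m (- mat 1))"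
      unfolding v_def by (simp add: smult_add matrix_add_ldistrib sq quat_mult)
    ultimately have "v ** v = (- mat 1 + (l *m (i ** j) + (l * m) *m (- j)))
        + (l *m (- (i ** j) + (l *m (- mat 1) + (l * m) *m i))
        + (l * m) *m (j + (l *m (- i) + (l * m) *m (- mat 1))))"
      by (subst (1) v_def) (simp add: matrix_add_rdistrib)
    also have "\<dots> = - (1 + (l * l + l * m * (l * m))) *m mat 1"
      by (cases i rule: mat2_cases; cases j rule: mat2_cases; cases "i ** j" rule: mat2_cases)
        (simp add: mat2_simps algebra_simps)
    finally show ?thesis
      using three by (simp add: ll lm)
  qed
  then have "det v = 0"
    using traceless_square[OF tr] by (auto simp: mat2_simps)
  moreover have "v \<noteq> 0"
  proof
    assume "v = 0"
    then have "i ** v = 0"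
      by (simp add: matrix_matrix_mult_def vec_eq_iff)
    then have "trace (- mat 1 + (l *m (i ** j) + (l * m) *m (- j))) = 0"
      unfolding v_def by (simp add: smult_add matrix_add_ldistrib quat_square quat_mult trace_def)
    then have "trace (mat 1 :: 'a^2^2) = 0"
      by (simp add: trace_add trace_sub trace_quat_mult quat_trace)
    then show False
      using two_neq_0 by (simp add: mat2_simps)
  qed
  ultimately obtain a b where "x = mat a + b *m v"
    using commute_iff by blast
  then show ?thesis
    using tr \<open>det v = 0\<close> by (intro exI[of _ a] exI[of _ "b *m v"]) simp
qed

end

text \<open>\<open>not_fixes_line\<close> excludes fixed lines, and a transposition of two lines
  would fix the third. Only the two 3-cycles remain.\<close>

lemma permutes_lines_cases:
  fixes i j x :: "'a^2^2"
  assumes quat: "quat i j" and x: "det x = 1" "trace x \<noteq> 0" "\<And>s. x \<noteq> mat s"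
    and perm: "permutes_lines x i j"
  obtains (forward) "carries x i j" "carries x j (i ** j)" "carries x (i ** j) i"
    | (backward) "carries x j i" "carries x i (i ** j)" "carries x (i ** j) j"
proof -
  let ?k = "i ** j"
  have i: "carries x i i \<or> carries x i j \<or> carries x i ?k" and j: "carries x j i \<or> carries x j j \<or> carries x j ?k"
    using perm by (auto simp: permutes_lines_def)
  have ji: "carries x u (j ** i) \<longleftrightarrow> carries x u ?k" for u
    unfolding quat_anticommute(2)[OF quat] by (rule carries_uminus_right)
  have "\<not> carries x i i"
    using not_fixes_line[OF quat x] j by blast
  moreover have "\<not> carries x j j"
    using not_fixes_line[OF quat_swap[OF quat] x] i ji by blast
  moreover have "\<not> (carries x i j \<and> carries x j i)"
  proof
    assume "carries x i j \<and> carries x j i"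
    then have "carries x ?k ?k"
      using carries_prod[of x i j j i] ji by blast
    then show False
      using not_fixes_line[OF quat_rotate[OF quat] x] i quat_mult(1)[OF quat] by auto
  qed
  moreover have "\<not> (carries x i ?k \<and> carries x j ?k)"
    using carries_same_imp_proportional[of x i ?k j] x(1) quat_not_proportional[OF quat] by metis
  ultimately consider "carries x i j" "carries x j ?k" | "carries x i ?k" "carries x j i"
    using i j by blast
  then show thesis
  proof cases
    case 1
    then show thesis
      using forward carries_prod[of x i j j ?k] quat_mult(2)[OF quat] by simp
  next
    case 2
    then show thesis
      using backward carries_prod[of x i ?k j i] quat_mult(1)[OF quat] by simp
  qed
qed

text \<open>Swapping \<open>i\<close> and \<open>j\<close> reverses the 3-cycle, as
  \<open>j i = - i j\<close> spans the same line; so \<open>cycle_imp_nilpotent\<close> covers both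
  directions.\<close>

lemma permutes_lines_imp_unipotent:
  fixes i j x :: "'a^2^2"
  assumes "quat i j" "det x = 1" "trace x \<noteq> 0" "permutes_lines x i j"
  shows "\<exists>a n. x = mat a + n \<and> trace n = 0 \<and> det n = 0"
proof (cases "\<exists>s. x = mat s")
  case True
  then show ?thesis
    by (metis add.right_neutral det_0 trace_0 mat_0)
next
  case False
  then have "\<And>s. x \<noteq> mat s"
    by blast
  from assms(1-3) this assms(4) show ?thesis
  proof (cases rule: permutes_lines_cases)
    case forward
    then show ?thesis
      using cycle_imp_nilpotent[OF assms(1,2)] by blast
  next
    case backward
    then show ?thesis
      using cycle_imp_nilpotent[OF quat_swap[OF assms(1)] assms(2)]
        quat_anticommute(2)[OF assms(1)] carries_uminus_right by metis
  qed
qed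

section \<open>Traceless parts and the dichotomy for solvable pairs\<close>

lemma mat_mult_scalar: "mat l ** A = l *m A" "A ** mat l = l *m A" for A :: "'a^2^2"
  by (cases A rule: mat2_cases; simp add: mat2_simps)+

lemma traceless_part:
  fixes x :: "'a^2^2"
  obtains s v where "x = mat s + v" "trace v = 0"
proof -
  obtain a b c d where x: "x = mat2 a b c d"
    by (rule mat2_cases)
  have "x = mat (- (a + d)) + sl (d - a) b c"
    using double[of a] double[of d] by (simp add: x mat2_simps algebra_simps)
  then show thesis
    by (rule that) (simp add: mat2_simps)
qed

lemma det_mat_add:
  fixes v :: "'a^2^2"
  assumes "trace v = 0"
  shows "det (mat s + v) = s * s + det v"
  using assms by (rule traceless_cases) (simp add: mat2_simps algebra_simps)

lemma trace_mat_add: "trace (mat s + v) = trace v - s" for v :: "'a^2^2"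
  using double[of s] by (cases v rule: mat2_cases) (simp add: mat2_simps algebra_simps)

lemma scalar_normalises: "l \<noteq> 0 \<Longrightarrow> normalises (mat l) v" for v :: "'a^2^2"
  unfolding carries_def by (intro exI[of _ 1]) (simp add: mat_mult_scalar)

theorem sol_imp_line_or_quat:
  fixes x y :: "'a^2^2"
  assumes det: "det x = 1" "det y = 1" and sol: "sol x y"
  obtains (line) v where "v \<noteq> 0" "trace v = 0" "normalises x v" "normalises y v"
    | (quat) i j where "quat i j" "permutes_lines x i j" "permutes_lines y i j"
proof (cases "x \<in> SL2_centre \<and> y \<in> SL2_centre")
  case True
  then have "normalises x (sl 1 0 0)" "normalises y (sl 1 0 0)"
    using scalar_normalises[of 1] scalar_normalises[of "-1"] by (auto simp: SL2_centre_def mat2_simps)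
  then show thesis
    by (intro line[of "sl 1 0 0"]) (simp_all add: mat2_simps)
next
  case False
  from sol_obtains_normal[OF det sol False] obtain A where
    detA: "\<And>a. a \<in> A \<Longrightarrow> det a = 1" and A: "\<not> A \<subseteq> SL2_centre"
    and comm: "\<And>a b. a \<in> A \<Longrightarrow> b \<in> A \<Longrightarrow> a ** b = b ** a \<or> a ** b = - (b ** a)"
    and conj: "\<And>a g. a \<in> A \<Longrightarrow> g \<in> {x, y} \<Longrightarrow> \<exists>b\<in>A. g ** a = b ** g"
    by blast
  have detg: "det g = 1" if "g \<in> {x, y}" for g
    using that det by auto
  from A obtain a where a: "a \<in> A" "a \<notin> SL2_centre"
    by blast
  obtain s v where a_eq: "a = mat s + v" and v: "trace v = 0"
    by (rule traceless_part)
  have "v \<noteq> 0"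
  proof
    assume "v = 0"
    then have "s * s = 1"
      using detA[OF a(1)] det_mat_add[OF v, of s] by (simp add: a_eq mat2_simps)
    then have "s = 1 \<or> s = -1"
      by (simp add: square_eq_1_iff)
    then show False
      using a(2) \<open>v = 0\<close> by (auto simp: a_eq SL2_centre_def mat2_simps)
  qed
  show thesis
  proof (cases "\<forall>b\<in>A. b ** a = a ** b")
    case True
    \<comment> \<open>The conjugate \<open>b\<close> of \<open>a\<close> by \<open>g\<close>
      centralises \<open>v\<close>, so \<open>b = c + d v\<close>; equal traces give
      \<open>c = s\<close>, and \<open>g a = b g\<close> reduces to
      \<open>g v = d v g\<close>.\<close>
    have "normalises g v" if g: "g \<in> {x, y}" for g
    proof -
      obtain b where b: "b \<in> A" "g ** a = b ** g"
        using conj[OF a(1) g] by blast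
      have "b ** v = v ** b"
        using True b(1) by (simp add: a_eq matrix_add_ldistrib matrix_add_rdistrib mat_mult_scalar)
      then obtain c d where bcd: "b = mat c + d *m v"
        using commute_iff[OF \<open>v \<noteq> 0\<close> v] by blast
      obtain z where z: "g ** z = mat 1" "z ** g = mat 1"
        using SL2_ex_inverse[OF detg[OF g]] by blast
      have "trace b = trace (b ** g ** z)"
        using z(1) by (simp add: matrix_mul_assoc[symmetric])
      also have "\<dots> = trace (z ** (g ** a))"
        unfolding b(2) by (rule trace_mul_sym)
      also have "\<dots> = trace a"
        using z(2) by (simp add: matrix_mul_assoc)
      finally have "c = s"
        using v by (simp add: a_eq bcd trace_mat_add)
      then have gv: "g ** v = d *m (v ** g)"
        using b(2) unfolding a_eq bcd
        by (simp add: matrix_add_ldistrib matrix_add_rdistrib mat_mult_scalar)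
      have "d \<noteq> 0"
      proof
        assume "d = 0"
        then have "g ** v = g ** 0"
          using gv by (simp add: matrix_matrix_mult_def vec_eq_iff)
        then show False
          using SL2_cancel_left[OF detg[OF g]] \<open>v \<noteq> 0\<close> by blast
      qed
      with gv show ?thesis
        unfolding carries_def by blast
    qed
    then show thesis
      using line[OF \<open>v \<noteq> 0\<close> v] by blast
  next
    case False
    then obtain b where b: "b \<in> A" "b ** a \<noteq> a ** b"
      by blast
    then have q: "quat a b"
      using comm[OF a(1) b(1)] detA[OF a(1)] detA[OF b(1)] unfolding quat_def by metis
    \<comment> \<open>Elements of \<open>A\<close> commute up to sign with \<open>a\<close> and
      \<open>b\<close>, so they are multiples of \<open>1\<close>, \<open>a\<close>,
      \<open>b\<close> or \<open>a b\<close>. A conjugate of \<open>u\<close> has trace zero and is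
      therefore not scalar.\<close>
    have "permutes_lines g a b" if g: "g \<in> {x, y}" for g
      unfolding permutes_lines_def
    proof
      fix u assume u: "u \<in> {a, b}"
      then have "u \<in> A" and tr: "trace u = 0"
        using a b quat_trace[OF q] by auto
      then obtain c where c: "c \<in> A" "g ** u = c ** g"
        using conj g by blast
      obtain l w where lw: "w \<in> {mat 1, a, b, a ** b}" "c = l *m w"
        using fixes_lines[OF q comm[OF c(1) a(1)] comm[OF c(1) b(1)]] by blast
      have "det w = 1"
        using lw(1) quat_det[OF q] by auto
      then have "l * l = 1"
        using detA[OF c(1)] lw(2) by simp
      then have "l \<noteq> 0"
        by auto
      have "w \<noteq> mat 1"
      proof
        assume "w = mat 1"
        then have "g ** u = g ** (l *m mat 1)"
          using c(2) lw(2) by simp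
        then have "u = l *m mat 1"
          by (rule SL2_cancel_left[OF detg[OF g]])
        then show False
          using tr \<open>l \<noteq> 0\<close> double_eq_0_iff by (simp add: mat2_simps)
      qed
      moreover have "carries g u w"
        unfolding carries_def using c(2) lw(2) \<open>l \<noteq> 0\<close> by (intro exI[of _ l]) simp
      ultimately show "carries g u a \<or> carries g u b \<or> carries g u (a ** b)"
        using lw(1) by blast
    qed
    then show thesis
      using quat[OF q] by blast
  qed
qed

section \<open>Solvabilizers of torus elements and unipotents\<close>

text \<open>Nonzero \<open>a\<close> and \<open>b\<close> exclude the quaternion case, where
  \<open>x\<close> would be unipotent up to sign. The lines normalised by \<open>x\<close> are then
  that of \<open>v\<close> and the nilpotent ones orthogonal to \<open>v\<close>, which give the
  Borel subgroups containing \<open>x\<close>. As \<open>a\<close> and \<open>b\<close> do not occur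
  on the right, the solvabilizer depends only on the torus.\<close>

lemma sol_torus_iff:
  fixes v x y :: "'a^2^2"
  assumes v: "trace v = 0" "det v \<noteq> 0" and x: "x = mat a + b *m v" "a \<noteq> 0" "b \<noteq> 0"
    and det: "det x = 1" "det y = 1"
  shows "sol x y \<longleftrightarrow> y ** v = v ** y \<or> y ** v = - (v ** y) \<or>
    (\<exists>w. w \<noteq> 0 \<and> trace w = 0 \<and> det w = 0 \<and> trace (v ** w) = 0 \<and> trace (y ** w) = 0)"
proof -
  have "v \<noteq> 0"
    using v by (auto simp: mat2_simps)
  have tr_x: "trace x \<noteq> 0"
    using x v by (simp add: trace_mat_add)
  have xw: "trace (x ** w) = b * trace (v ** w)" if "trace w = 0" for w
    using that by (simp add: x(1) matrix_add_rdistrib trace_add mat_mult_scalar)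
  have det_v: "det (b *m v) \<noteq> 0"
    using x v by simp
  show ?thesis
  proof
    assume s: "sol x y"
    from det s show "y ** v = v ** y \<or> y ** v = - (v ** y) \<or>
      (\<exists>w. w \<noteq> 0 \<and> trace w = 0 \<and> det w = 0 \<and> trace (v ** w) = 0 \<and> trace (y ** w) = 0)"
    proof (cases rule: sol_imp_line_or_quat)
      case (line w)
      show ?thesis
      proof (cases "det w = 0")
        case True
        then have "trace (v ** w) = 0" "trace (y ** w) = 0"
          using normalises_nilpotent_imp[OF _ line(1,2)] line(3,4) xw[OF line(2)] x(3) by auto
        then show ?thesis
          using line True by blast
      next
        case False
        then have "x ** w = w ** x"
          using normalises_nonsingular[OF line(3) _ det(1)] anticommute_iff[OF line(1,2)] tr_x by blast
        then have "w ** v = v ** w"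
          using x(3) unfolding x(1)
          by (simp add: matrix_add_ldistrib matrix_add_rdistrib mat_mult_scalar)
            (metis smult_cancel)
        then obtain c d where w: "w = mat c + d *m v"
          using commute_iff[OF \<open>v \<noteq> 0\<close> v(1)] by blast
        then have "c = 0"
          using line(2) v(1) by (simp add: trace_mat_add)
        then have w: "w = d *m v" and "d \<noteq> 0"
          using w line(1) by (auto simp: mat2_simps)
        have "y ** w = w ** y \<or> y ** w = - (w ** y)"
          using normalises_nonsingular[OF line(4) False det(2)] .
        then have "d *m (y ** v) = d *m (v ** y) \<or> d *m (y ** v) = d *m (- (v ** y))"
          unfolding w by simp
        then show ?thesis
          by (elim disjE) (drule smult_cancel[OF \<open>d \<noteq> 0\<close>], simp only: simp_thms)+
      qed
    next
      case (quat i j)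
      from permutes_lines_imp_unipotent[OF quat(1) det(1) tr_x quat(2)]
      obtain c n where n: "x = mat c + n" "trace n = 0" "det n = 0"
        by blast
      have "trace (b *m v) = 0"
        using v by simp
      then have "trace x = - a"
        unfolding x(1) by (simp only: trace_mat_add diff_0)
      moreover have "trace x = - c"
        using n(2) unfolding n(1) by (simp only: trace_mat_add diff_0)
      ultimately have "c = a"
        by simp
      then have "n = b *m v"
        using n(1) x(1) by simp
      then show ?thesis
        using n(3) det_v by simp
    qed
  next
    assume "y ** v = v ** y \<or> y ** v = - (v ** y) \<or>
      (\<exists>w. w \<noteq> 0 \<and> trace w = 0 \<and> det w = 0 \<and> trace (v ** w) = 0 \<and> trace (y ** w) = 0)"
    then consider "y ** v = v ** y \<or> y ** v = - (v ** y)"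
      | w where "w \<noteq> 0" "trace w = 0" "det w = 0" "trace (v ** w) = 0" "trace (y ** w) = 0"
      by blast
    then show "sol x y"
    proof cases
      case 1
      then have "\<exists>l. l \<noteq> 0 \<and> y ** v = l *m (v ** y)"
        by (elim disjE) (rule exI[of _ 1] exI[of _ "-1"], simp)+
      moreover have "x ** v = v ** x"
        using commute_iff[OF \<open>v \<noteq> 0\<close> v(1)] x(1) by blast
      then have "\<exists>l. l \<noteq> 0 \<and> x ** v = l *m (v ** x)"
        by (intro exI[of _ 1]) simp
      ultimately show ?thesis
        using sol_if_normalises[OF \<open>v \<noteq> 0\<close> v(1) det] by (simp add: carries_def)
    next
      case 2
      then show ?thesis
        using sol_if_normalises[OF 2(1,2) det] normalises_nilpotent_if[OF 2(1-3)] det xw by simp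
    qed
  qed
qed

text \<open>A nonsplit torus element lies in no Borel subgroup, so only the torus normaliser
  remains. This makes \<open>x\<close> a probe for commuting up to sign with
  \<open>v\<close>.\<close>

lemma sol_nonsplit_torus_iff:
  fixes v x y :: "'a^2^2"
  assumes v: "trace v = 0" "det v = 1" and x: "x = mat a + b *m v" "a \<noteq> 0" "b \<noteq> 0"
    and det: "det x = 1" "det y = 1"
  shows "sol x y \<longleftrightarrow> y ** v = v ** y \<or> y ** v = - (v ** y)"
proof -
  have "det v \<noteq> 0"
    using v by simp
  from sol_torus_iff[OF v(1) this x det] involution_not_orthogonal_to_nilpotent[OF v] show ?thesis
    by blast
qed

text \<open>If \<open>w\<close> were nonsingular, \<open>1 + n\<close> would commute with it, making
  \<open>n\<close> a multiple of \<open>w\<close>, although \<open>n\<close> is nonzero and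
  singular.\<close>

lemma unipotent_normalises_imp:
  fixes n w :: "'a^2^2"
  assumes n: "n \<noteq> 0" "trace n = 0" "det n = 0" and w: "w \<noteq> 0" "trace w = 0"
    and norm: "normalises (mat 1 + n) w"
  shows "det w = 0" "trace (n ** w) = 0"
proof -
  have det: "det (mat 1 + n) = 1" "trace (mat 1 + n) \<noteq> 0"
    using n by (simp_all add: det_mat_add trace_mat_add)
  show "det w = 0"
  proof (rule ccontr)
    assume "det w \<noteq> 0"
    then have "(mat 1 + n) ** w = w ** (mat 1 + n)"
      using normalises_nonsingular[OF norm _ det(1)] anticommute_iff[OF w] det(2) by blast
    then obtain a b where ab: "mat 1 + n = mat a + b *m w"
      using commute_iff[OF w] by blast
    have tr: "trace (b *m w) = 0"
      using w by simp
    have "trace (mat 1 + n) = - 1" "trace (mat a + b *m w) = - a"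
      using n(2) tr by (simp_all only: trace_mat_add diff_0)
    then have "a = 1"
      unfolding ab by simp
    then have "n = b *m w"
      using ab by simp
    then show False
      using n(1,3) \<open>det w \<noteq> 0\<close> by auto
  qed
  then have "trace ((mat 1 + n) ** w) = 0"
    using normalises_nilpotent_imp[OF norm w] by simp
  then show "trace (n ** w) = 0"
    using w by (simp add: matrix_add_rdistrib trace_add)
qed

text \<open>The torus normaliser does not contain \<open>1 + n\<close>, and the \<open>w\<close> in
  \<open>sol_torus_iff\<close> must be proportional to \<open>n\<close>, whose Borel subgroup is the
  only one containing \<open>1 + n\<close>.\<close>

lemma sol_torus_unipotent_iff:
  fixes v x n :: "'a^2^2"
  assumes v: "trace v = 0" "det v \<noteq> 0" and x: "x = mat a + b *m v" "a \<noteq> 0" "b \<noteq> 0" "det x = 1"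
    and n: "n \<noteq> 0" "trace n = 0" "det n = 0"
  shows "sol x (mat 1 + n) \<longleftrightarrow> trace (v ** n) = 0"
proof -
  have "v \<noteq> 0"
    using v by (auto simp: mat2_simps)
  have det_n: "det (mat 1 + n) = 1"
    using n by (simp add: det_mat_add)
  have nw: "trace ((mat 1 + n) ** w) = trace (n ** w)" if "trace w = 0" for w
    using that by (simp add: matrix_add_rdistrib trace_add)
  have nn: "trace (n ** n) = 0"
    using traceless_square[OF n(2)] n(3) by (simp add: mat2_simps)
  have "\<not> normalises (mat 1 + n) v"
    using unipotent_normalises_imp(1)[OF n \<open>v \<noteq> 0\<close> v(1)] v(2) by blast
  then have "(mat 1 + n) ** v \<noteq> v ** (mat 1 + n)" "(mat 1 + n) ** v \<noteq> - (v ** (mat 1 + n))"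
    unfolding carries_def by (metis one_neq_zero smult_simps(4), metis neg_equal_0_iff_equal one_neq_zero smult_simps(5))
  then have "sol x (mat 1 + n) \<longleftrightarrow>
    (\<exists>w. w \<noteq> 0 \<and> trace w = 0 \<and> det w = 0 \<and> trace (v ** w) = 0 \<and> trace (n ** w) = 0)"
    using sol_torus_iff[OF v x det_n] nw by metis
  also have "\<dots> \<longleftrightarrow> trace (v ** n) = 0"
  proof
    assume "\<exists>w. w \<noteq> 0 \<and> trace w = 0 \<and> det w = 0 \<and> trace (v ** w) = 0 \<and> trace (n ** w) = 0"
    then obtain w where w: "w \<noteq> 0" "trace w = 0" "det w = 0" "trace (v ** w) = 0" "trace (n ** w) = 0"
      by blast
    obtain k where "k \<noteq> 0" "w = k *m n"
      using nilpotent_orthogonal[OF n w(1-3,5)] by blast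
    then show "trace (v ** n) = 0"
      using w(4) by simp
  next
    assume "trace (v ** n) = 0"
    then show "\<exists>w. w \<noteq> 0 \<and> trace w = 0 \<and> det w = 0 \<and> trace (v ** w) = 0 \<and> trace (n ** w) = 0"
      using n nn by blast
  qed
  finally show ?thesis .
qed

section \<open>Pairs of unipotents\<close>

definition nilpotents :: "('a^2^2) set" where
  "nilpotents = {n. n \<noteq> 0 \<and> trace n = 0 \<and> det n = 0}"

lemma trace_zero [simp]: "trace (0 :: 'a^2^2) = 0"
  by (simp add: trace_def)

lemma nilpotent_square: "trace n = 0 \<Longrightarrow> det n = 0 \<Longrightarrow> n ** n = 0" for n :: "'a^2^2"
  using traceless_square[of n] by simp

lemma unipotent:
  assumes "n \<in> nilpotents"
  shows "det (mat 1 + n) = 1" "trace (mat 1 + n) \<noteq> 0" "mat 1 + n \<noteq> mat s"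
    "(mat 1 + n) ** (mat 1 - n) = mat 1" "(mat 1 - n) ** (mat 1 + n) = mat 1"
proof -
  have n: "n \<noteq> 0" "trace n = 0" "det n = 0"
    using assms by (auto simp: nilpotents_def)
  show "det (mat 1 + n) = 1" "trace (mat 1 + n) \<noteq> 0"
    using n by (simp_all add: det_mat_add trace_mat_add)
  obtain p q r where n': "n = sl p q r"
    using n(2) by (rule traceless_cases)
  have pqr: "p * p + q * r = 0"
    using n(3) by (simp add: n' mat2_simps algebra_simps add_eq_0_iff)
  show "(mat 1 + n) ** (mat 1 - n) = mat 1" "(mat 1 - n) ** (mat 1 + n) = mat 1"
    using pqr by (simp_all add: n' mat2_simps algebra_simps)
  show "mat 1 + n \<noteq> mat s"
  proof
    assume *: "mat 1 + n = mat s"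
    then have "trace (mat 1 + n) = trace (mat s + (0 :: 'a^2^2))"
      by simp
    then have "s = 1"
      using n(2) unfolding trace_mat_add by simp
    then show False
      using * n(1) by simp
  qed
qed

lemma uminus_nilpotents: "n \<in> nilpotents \<Longrightarrow> - n \<in> nilpotents"
  unfolding nilpotents_def by (cases n rule: mat2_cases) (auto simp: mat2_simps add_eq_0_iff)

lemma smult_nilpotents: "n \<in> nilpotents \<Longrightarrow> k \<noteq> 0 \<Longrightarrow> k *m n \<in> nilpotents"
  unfolding nilpotents_def by (auto simp: smult_eq_0_iff)

lemma sol_unipotent_uminus:
  assumes "n \<in> nilpotents" "det y = 1"
  shows "sol (mat 1 - n) y \<longleftrightarrow> sol (mat 1 + n) y"
  by (rule sol_inv[OF unipotent(1)[OF assms(1)] assms(2) unipotent(4)[OF assms(1)]])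

text \<open>Modulo the centre, \<open>x\<close> and \<open>y\<close> have order 3, and
  \<open>x y\<close> has order 2 because its trace is \<open>2 + 1 = 0\<close>: these are the
  relations of A4. The lines of \<open>x y\<close> and of its conjugates by powers of
  \<open>x\<close> are permuted cyclically by both generators.\<close>

lemma sol_unipotents_if_trace_1:
  assumes mn: "m \<in> nilpotents" "n \<in> nilpotents" and tr: "trace (m ** n) = 1"
  shows "sol (mat 1 + m) (mat 1 + n)"
proof -
  define x x' y y' where "x = mat 1 + m" "x' = mat 1 - m" "y = mat 1 + n" "y' = mat 1 - n"
  note xy_def = this
  have m: "trace m = 0" "m ** m = 0" and n: "trace n = 0" "n ** n = 0"
    using mn nilpotent_square by (auto simp: nilpotents_def)
  have double_matrix: "k + k = - k" for k :: "'a^2^2"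
    using double by (cases k rule: mat2_cases) (simp add: mat2_simps)
  have inv: "x ** x' = mat 1" "x' ** x = mat 1" "y ** y' = mat 1" "y' ** y = mat 1"
    and det: "det x = 1" "det y = 1"
    using unipotent mn by (simp_all add: xy_def)
  have sq: "x ** x = x'" "y ** y = y'"
  proof -
    have "(mat 1 + k) ** (mat 1 + k) = mat 1 + (k + k) + k ** k" for k :: "'a^2^2"
      by (simp add: matrix_add_ldistrib matrix_add_rdistrib)
    from this[of m] this[of n] show "x ** x = x'" "y ** y = y'"
      by (simp_all add: xy_def m n double_matrix)
  qed
  have "trace (x ** y) = 0"
    unfolding xy_def using m n tr three
    by (simp add: matrix_add_ldistrib matrix_add_rdistrib trace_add trace_I two)
  moreover have detu: "det (x ** y) = 1"
    using det by (simp add: det_mul)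
  ultimately have q: "x ** y ** x ** y = - mat 1"
    using traceless_square[of "x ** y"] by (simp add: matrix_mul_assoc)
  \<comment> \<open>Both inverses are read off from \<open>(x y)^2 = -1\<close>.\<close>
  have y': "y' = - (x ** y ** x)"
  proof -
    have "x ** y ** x = x ** y ** x ** y ** y'"
      using inv by (simp add: matrix_mul_assoc[symmetric])
    then show ?thesis
      unfolding q by (simp add: matrix_uminus)
  qed
  have x': "x' = - (y ** x ** y)"
  proof -
    have "y ** x ** y = x' ** (x ** y ** x ** y)"
      using inv by (simp add: matrix_mul_assoc)
    then show ?thesis
      unfolding q by (simp add: matrix_uminus)
  qed
  have carries_eq: "carries g u v" if "g ** u = v ** g" for g u v :: "'a^2^2"
    unfolding carries_def using that by (intro exI[of _ 1]) simp
  have carries_neg: "carries g u v" if "g ** u = - (v ** g)" for g u v :: "'a^2^2"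
    unfolding carries_def using that by (intro exI[of _ "-1"]) simp
  show ?thesis
    unfolding xy_def(1,3)[symmetric]
  proof (rule sol_if_cyclic[where u = "x ** y" and v = "x' ** y ** x'" and w = "y ** x"])
    show "x ** y \<noteq> 0"
      using detu SL2_nonzero by blast
    show "carries x (x ** y) (x' ** y ** x')"
      using inv sq by (intro carries_eq) (metis matrix_mul_assoc matrix_mul_rid)
    show "carries x (x' ** y ** x') (y ** x)"
      using inv sq by (intro carries_eq) (metis matrix_mul_assoc matrix_mul_lid)
    show "carries x (y ** x) (x ** y)" "carries y (x ** y) (y ** x)"
      by (intro carries_eq; simp add: matrix_mul_assoc)+
    \<comment> \<open>Replacing \<open>y'\<close> by \<open>- x y x\<close> and using
      \<open>x^3 = 1\<close> collapses the words; the outcome is that \<open>y\<close> rotates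
      against \<open>x\<close>.\<close>
    have "y' ** x ** y' = x ** y ** (x ** x ** x) ** y ** x"
      unfolding y' by (simp add: matrix_uminus matrix_mul_assoc)
    also have "\<dots> = x ** y' ** x"
      using inv sq by (metis matrix_mul_assoc matrix_mul_rid)
    finally have "y' ** x = x ** y' ** x ** y"
      using inv by (metis matrix_mul_assoc matrix_mul_rid)
    also have "\<dots> = - (x ** x ** y ** x ** x ** y)"
      unfolding y' by (simp add: matrix_uminus matrix_mul_assoc)
    finally show "carries y (y ** x) (x' ** y ** x')"
      using sq by (intro carries_neg) (metis matrix_mul_assoc)
    have "y ** (x' ** y ** x') = y ** y ** x ** (y ** y ** y) ** x ** y"
      unfolding x' by (simp add: matrix_uminus matrix_mul_assoc)
    also have "\<dots> = y' ** x' ** y"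
      using inv sq by (metis matrix_mul_assoc matrix_mul_rid)
    also have "\<dots> = - (x ** y ** y)"
      unfolding y' using inv by (simp add: matrix_uminus) (metis matrix_mul_assoc matrix_mul_rid)
    finally show "carries y (x' ** y ** x') (x ** y)"
      by (rule carries_neg)
  qed (use det \<open>trace (x ** y) = 0\<close> in auto)
qed

text \<open>In the quaternion case both unipotents act as 3-cycles on the lines, so their product or
  quotient fixes all three and is scalar or traceless by \<open>normalises_both\<close>. Its trace
  is \<open>-1 + tr(m n)\<close> or \<open>-1 - tr(m n)\<close>; being scalar makes \<open>n\<close>
  proportional to \<open>m\<close>, so that \<open>tr(m n) = 0\<close>.\<close>

lemma sol_unipotents_iff:
  assumes mn: "m \<in> nilpotents" "n \<in> nilpotents"
  shows "sol (mat 1 + m) (mat 1 + n) \<longleftrightarrow> trace (m ** n) \<in> {0, 1, -1}"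
proof
  have m: "m \<noteq> 0" "trace m = 0" "det m = 0" and n: "n \<noteq> 0" "trace n = 0" "det n = 0"
    using mn by (auto simp: nilpotents_def)
  note um = unipotent[OF mn(1)] and un = unipotent[OF mn(2)]
  let ?x = "mat 1 + m" and ?y = "mat 1 + n" and ?y' = "mat 1 - n"
  have mm: "trace (m ** m) = 0"
    using nilpotent_square[OF m(2,3)] by simp
  {
    assume s: "sol ?x ?y"
    from um(1) un(1) s show "trace (m ** n) \<in> {0, 1, -1}"
    proof (cases rule: sol_imp_line_or_quat)
      case (line v)
      note v = unipotent_normalises_imp[OF m line(1,2,3)] unipotent_normalises_imp[OF n line(1,2,4)]
      obtain k where "v = k *m m" "k \<noteq> 0"
        using nilpotent_orthogonal[OF m line(1,2) v(1,2)] by blast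
      then show ?thesis
        using v(4) trace_mul_sym[of m n] by simp
    next
      case (quat i j)
      \<comment> \<open>The value \<open>e = 1\<close> treats the product; \<open>e = -1\<close>
        treats the quotient, as \<open>1 - n\<close> is the inverse of \<open>1 + n\<close>.\<close>
      have scalar_or_trace: "trace (m ** n) \<in> {0, 1, -1}"
        if e: "e * e = 1" and c: "(\<exists>l. ?x ** (mat 1 + e *m n) = mat l) \<or> trace (?x ** (mat 1 + e *m n)) = 0" for e
        using c
      proof
        assume "trace (?x ** (mat 1 + e *m n)) = 0"
        then have "- 1 + e * trace (m ** n) = 0"
          by (simp add: matrix_add_ldistrib matrix_add_rdistrib trace_add trace_I two m n)
        then have "trace (m ** n) = e"
          using e by Groebner_Basis.algebra
        moreover have "e = 1 \<or> e = -1"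
          using e by (simp add: square_eq_1_iff)
        ultimately show ?thesis
          by auto
      next
        assume "\<exists>l. ?x ** (mat 1 + e *m n) = mat l"
        then obtain l where l: "?x ** (mat 1 + e *m n) = mat l"
          by blast
        have "mat 1 + e *m n = (mat 1 - m) ** (?x ** (mat 1 + e *m n))"
          using um(5) by (simp add: matrix_mul_assoc)
        also have "\<dots> = l *m (mat 1 + (- m))"
          unfolding l by (simp add: mat_mult_scalar)
        finally have eq: "mat 1 + e *m n = l *m (mat 1 + (- m))" .
        have "trace (mat 1 + e *m n) = - 1" "trace (l *m (mat 1 + (- m))) = - l"
          using m(2) n(2) trace_sub[of 0 m] unfolding smult_simps(8) trace_mat_add by simp_all
        then have "l = 1"
          unfolding eq by simp
        then have "e *m n = - m"
          using eq by simp
        then have "m ** (e *m n) = 0"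
          using nilpotent_square[OF m(2,3)] by (simp add: matrix_uminus)
        then have "e * trace (m ** n) = 0"
          by (metis smult_simps(2,8) trace_zero)
        then have "trace (m ** n) = 0"
          using e by auto
        then show ?thesis
          by simp
      qed
      have cd: "det (?x ** ?y) = 1" "det (?x ** ?y') = 1"
        using um(1) un(1) det_mul[of ?y ?y'] un(4) by (simp_all add: det_mul)
      have inv: "carries ?y' w v" if "carries ?y v w" for v w
        by (rule carries_inverse[OF that un(4,5)])
      let ?k = "i ** j"
      have qki: "quat ?k i" and qjk: "quat j ?k"
        using quat_rotate[OF quat(1)] quat_rotate[OF quat_rotate[OF quat(1)]] quat_mult(1)[OF quat(1)] by simp_all
      have y: "?x ** ?y = ?x ** (mat 1 + 1 *m n)" "?x ** ?y' = ?x ** (mat 1 + (-1) *m n)"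
        by simp_all
      note plus = scalar_or_trace[of 1, folded y(1)] and minus = scalar_or_trace[of "-1", folded y(2)]
      from quat(1) um(1-3) quat(2) show ?thesis
      proof (cases rule: permutes_lines_cases)
        case x: forward
        from quat(1) un(1-3) quat(3) show ?thesis
        proof (cases rule: permutes_lines_cases)
          case forward
          \<comment> \<open>Equal directions cancel in the quotient, opposite ones in the
            product.\<close>
          then have "normalises (?x ** ?y') j" "normalises (?x ** ?y') ?k"
            using x inv carries_mult by blast+
          then show ?thesis
            using minus normalises_both[OF qjk cd(2)] by simp
        next
          case backward
          then have "normalises (?x ** ?y) i" "normalises (?x ** ?y) j"
            using x carries_mult by blast+
          then show ?thesis
            using plus normalises_both[OF quat(1) cd(1)] by simp
        qed
      next
        case x: backward
        from quat(1) un(1-3) quat(3) show ?thesis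
        proof (cases rule: permutes_lines_cases)
          case forward
          then have "normalises (?x ** ?y) i" "normalises (?x ** ?y) j"
            using x carries_mult by blast+
          then show ?thesis
            using plus normalises_both[OF quat(1) cd(1)] by simp
        next
          case backward
          then have "normalises (?x ** ?y') ?k" "normalises (?x ** ?y') i"
            using x inv carries_mult by blast+
          then show ?thesis
            using minus normalises_both[OF qki cd(2)] by simp
        qed
      qed
    qed
  }
  assume "trace (m ** n) \<in> {0, 1, -1}"
  then consider "trace (m ** n) = 0" | "trace (m ** n) = 1" | "trace (m ** n) = -1"
    by blast
  then show "sol ?x ?y"
  proof cases
    case 1
    then have "trace (n ** m) = 0"
      using trace_mul_sym[of m n] by simp
    then have "trace (?x ** m) = 0" "trace (?y ** m) = 0"
      using mm m(2) by (simp_all add: matrix_add_rdistrib trace_add)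
    then show ?thesis
      using sol_if_normalises[OF m(1,2) um(1) un(1)] normalises_nilpotent_if[OF m] um(1) un(1) by blast
  next
    case 2
    then show ?thesis
      by (rule sol_unipotents_if_trace_1[OF mn])
  next
    case 3
    then have "trace ((- m) ** n) = 1"
      using trace_sub[of 0 "m ** n"] by (simp add: matrix_uminus)
    then have "sol (mat 1 + (- m)) ?y"
      by (rule sol_unipotents_if_trace_1[OF uminus_nilpotents[OF mn(1)] mn(2)])
    then show ?thesis
      using sol_unipotent_uminus[OF mn(1) un(1)] by simp
  qed
qed

end

section \<open>Counting traceless matrices of given determinant\<close>

lemma card_image_two_to_one:
  fixes f :: "'a::group_add \<Rightarrow> 'b"
  assumes A: "finite A" "\<And>v. v \<in> A \<Longrightarrow> - v \<in> A" "\<And>v. v \<in> A \<Longrightarrow> - v \<noteq> v"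
    and f: "\<And>v w. v \<in> A \<Longrightarrow> w \<in> A \<Longrightarrow> f v = f w \<longleftrightarrow> w = v \<or> w = - v"
  shows "card A = 2 * card (f ` A)"
proof -
  have "card {v \<in> A. f v = y} = 2" if y: "y \<in> f ` A" for y
  proof -
    obtain w where w: "w \<in> A" "y = f w"
      using y by blast
    then have "{v \<in> A. f v = y} = {w, - w}"
      using A(2) f by (auto simp: eq_commute[of "f w"])
    then show ?thesis
      using A(3)[OF w(1)] by (metis card_2_iff)
  qed
  then have "(\<Sum>y\<in>f ` A. card {v \<in> A. f v = y}) = 2 * card (f ` A)"
    by simp
  moreover have "card A = (\<Sum>y\<in>f ` A. card {v \<in> A. f v = y})"
    using sum.image_gen[OF A(1), of "\<lambda>_. 1::nat" f] by simp
  ultimately show ?thesis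
    by simp
qed

lemma card_mult_eq:
  fixes f :: "'a::{field, finite}"
  shows "card {(x, y). x * y = f} = (if f = 0 then 2 * CARD('a) - 1 else CARD('a) - 1)"
proof (cases "f = 0")
  case True
  have "{(x, y). x * y = f} = {0} \<times> UNIV \<union> (UNIV - {0}) \<times> {0}"
    using True by auto
  moreover have "card ({0::'a} \<times> (UNIV :: 'a set) \<union> (UNIV - {0::'a}) \<times> {0::'a})
      = card ({0::'a} \<times> (UNIV :: 'a set)) + card ((UNIV - {0::'a}) \<times> {0::'a})"
    by (rule card_Un_disjoint) auto
  moreover have "CARD('a) > 0"
    by simp
  ultimately show ?thesis
    using True by (simp add: card_cartesian_product card_Diff_singleton)
next
  case False
  have "bij_betw (\<lambda>x. (x, f / x)) (UNIV - {0}) {(x, y). x * y = f}"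
    using False by (intro bij_betwI[where g = fst]) (auto simp: field_simps)
  then show ?thesis
    using False bij_betw_same_card by (fastforce simp: card_Diff_singleton)
qed

text \<open>Over each \<open>p\<close>, the equation \<open>q * r = e - p * p\<close> has
  \<open>CARD('a) - 1\<close> solutions, and \<open>CARD('a)\<close> more if its right-hand side
  vanishes.\<close>

lemma card_quadric:
  fixes e :: "'a::{field, finite}"
  shows "card {(p, q, r). p * p + q * r = e} + CARD('a)
    = CARD('a) * CARD('a) + card {p. p * p = e} * CARD('a)"
proof -
  let ?S = "{p. p * p = e}" and ?q = "CARD('a)"
  have q: "?q > 0"
    by simp
  have "{(p, q, r). p * p + q * r = e} = Sigma UNIV (\<lambda>p. {(x, y). x * y = e - p * p})"
    by (auto simp: algebra_simps)
  then have "card {(p, q, r). p * p + q * r = e} = (\<Sum>p\<in>UNIV. card {(x, y). x * y = e - p * p})"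
    by (simp add: card_SigmaI)
  also have "\<dots> = (\<Sum>p\<in>UNIV. (?q - 1) + (if p \<in> ?S then ?q else 0))"
    by (intro sum.cong) (auto simp: card_mult_eq)
  also have "\<dots> = ?q * (?q - 1) + card ?S * ?q"
    unfolding sum.distrib sum.If_cases[OF finite] by simp
  finally have "card {(p, q, r). p * p + q * r = e} = ?q * (?q - 1) + card ?S * ?q" .
  moreover have "?q * (?q - 1) + ?q = ?q * ?q"
    using q by (cases ?q) simp_all
  ultimately show ?thesis
    by linarith
qed

context char3_field
begin

definition involutions :: "('a^2^2) set" where
  "involutions = {v. trace v = 0 \<and> det v = 1}"

text \<open>Having square \<open>1\<close> and determinant \<open>-1\<close>, these lie outside
  \<open>SL2\<close>; they span the traceless parts of the split tori.\<close>

definition reflections :: "('a^2^2) set" where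
  "reflections = {v. trace v = 0 \<and> det v = -1}"

lemma card_traceless: "card {v :: 'a^2^2. trace v = 0 \<and> det v = d} = card {(p, q, r). p * p + q * r = - d}"
proof -
  have "bij_betw (\<lambda>(p, q, r). sl p q r) {(p, q, r). p * p + q * r = - d} {v. trace v = 0 \<and> det v = d}"
  proof (rule bij_betw_imageI)
    show "inj_on (\<lambda>(p, q, r). sl p q r) {(p, q, r). p * p + q * r = - d}"
      by (auto simp: inj_on_def)
    show "(\<lambda>(p, q, r). sl p q r) ` {(p, q, r). p * p + q * r = - d} = {v. trace v = 0 \<and> det v = d}"
    proof (intro equalityI subsetI)
      fix v :: "'a^2^2" assume v: "v \<in> {v. trace v = 0 \<and> det v = d}"
      then obtain p q r where v': "v = sl p q r"
        using traceless_cases[of v] by auto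
      then have d: "- (p * p) - q * r = d"
        using v by (simp add: mat2_simps)
      have "p * p + q * r = - d"
        unfolding d[symmetric] by simp
      then show "v \<in> (\<lambda>(p, q, r). sl p q r) ` {(p, q, r). p * p + q * r = - d}"
        using v' by (intro image_eqI[of _ _ "(p, q, r)"]) auto
    next
      fix v :: "'a^2^2" assume "v \<in> (\<lambda>(p, q, r). sl p q r) ` {(p, q, r). p * p + q * r = - d}"
      then obtain p q r where v: "v = sl p q r" "p * p + q * r = - d"
        by auto
      have "det v = - (p * p + q * r)"
        by (simp add: v(1) mat2_simps)
      then show "v \<in> {v. trace v = 0 \<and> det v = d}"
        unfolding v(2) by (simp add: v(1) mat2_simps)
    qed
  qed
  then show ?thesis
    using bij_betw_same_card by fastforce
qed

lemma card_nilpotents: "card nilpotents + 1 = CARD('a) * CARD('a)"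
proof -
  have "{v :: 'a^2^2. trace v = 0 \<and> det v = 0} = insert 0 nilpotents"
    by (auto simp: nilpotents_def mat2_simps)
  moreover have "0 \<notin> nilpotents"
    by (simp add: nilpotents_def)
  ultimately have "card nilpotents + 1 = card {v :: 'a^2^2. trace v = 0 \<and> det v = 0}"
    by simp
  moreover have "{p :: 'a. p * p = 0} = {0}"
    by auto
  ultimately show ?thesis
    using card_quadric[of "0::'a"] by (simp add: card_traceless)
qed

lemma card_involutions: "card involutions + CARD('a) = CARD('a) * CARD('a)"
proof -
  have "{p :: 'a. p * p = -1} = {}"
    using minus_one_nonsquare by auto
  then show ?thesis
    using card_quadric[of "-1::'a"] by (simp add: involutions_def card_traceless)
qed

lemma card_reflections: "card reflections = CARD('a) * CARD('a) + CARD('a)"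
proof -
  have "{p :: 'a. p * p = 1} = {1, -1}"
    by (auto simp: square_eq_1_iff)
  then have "card {p :: 'a. p * p = 1} = 2"
    using minus_one_neq_one by simp
  then show ?thesis
    using card_quadric[of "1::'a"] by (simp add: reflections_def card_traceless)
qed

section \<open>The trace form on traceless matrices, and points on conics\<close>

lemma trace_square: "trace v = 0 \<Longrightarrow> trace (v ** v) = det v" for v :: "'a^2^2"
  using traceless_square[of v] by (simp add: trace_I two)

lemma det_traceless_add:
  fixes v w :: "'a^2^2"
  assumes "trace v = 0" "trace w = 0"
  shows "det (v + w) = det v + det w - trace (v ** w)"
proof -
  obtain p q r p' q' r' where "v = sl p q r" "w = sl p' q' r'"
    using assms traceless_cases by metis
  then show ?thesis
    by (simp add: mat2_simps algebra_simps)
qed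

lemma traceless_commute:
  fixes v w :: "'a^2^2"
  assumes "v \<noteq> 0" "trace v = 0" "trace w = 0" "w ** v = v ** w"
  obtains d where "w = d *m v"
proof -
  obtain c d where w: "w = mat c + d *m v"
    using assms commute_iff by blast
  have "trace (mat c + d *m v) = - c"
    using assms(2) unfolding trace_mat_add by simp
  then have "c = 0"
    using assms(3) unfolding w by simp
  then show thesis
    using that w by simp
qed

lemma proportional_same_det:
  fixes v w :: "'a^2^2"
  assumes "w = d *m v" "det w = det v" "det v \<noteq> 0"
  shows "w = v \<or> w = - v"
proof -
  have "d = 1 \<or> d = -1"
    using assms by (simp add: square_eq_1_iff)
  then show ?thesis
    using assms(1) by auto
qed

lemma ex_nilpotent_trace:
  assumes "m \<in> nilpotents" "c \<noteq> 0"
  obtains n where "n \<in> nilpotents" "trace (m ** n) = c"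
proof -
  have nz: "m \<noteq> 0" and tr: "trace m = 0" and det: "det m = 0"
    using assms(1) by (auto simp: nilpotents_def)
  obtain p q r where m: "m = sl p q r"
    using tr by (rule traceless_cases)
  have pqr: "q \<noteq> 0 \<or> r \<noteq> 0"
    using nz det by (auto simp: m mat2_simps)
  obtain n where n: "n \<in> nilpotents" "trace (m ** n) \<noteq> 0"
  proof (cases "q = 0")
    case True
    show thesis
      by (rule that[of "sl 0 1 0"]; use True pqr in \<open>simp add: nilpotents_def m mat2_simps\<close>)
  next
    case False
    show thesis
      by (rule that[of "sl 0 0 1"]; use False in \<open>simp add: nilpotents_def m mat2_simps\<close>)
  qed
  show thesis
    by (rule that[of "(c / trace (m ** n)) *m n"]) (use n assms(2) in \<open>simp_all add: smult_nilpotents\<close>)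
qed

text \<open>\<open>n\<close> and \<open>n'\<close> have as kernels the two eigenlines of
  \<open>u\<close>, and so give the Borel subgroups above the split torus. A traceless
  \<open>w\<close> orthogonal to both is diagonal in the same basis, hence a multiple of
  \<open>u\<close>.\<close>

lemma reflection_nilpotents:
  assumes "u \<in> reflections"
  obtains n n' where "n \<in> nilpotents" "n' \<in> nilpotents" "trace (u ** n) = 0" "trace (u ** n') = 0"
    "trace (n ** n') \<noteq> 0"
    "\<And>w. trace w = 0 \<Longrightarrow> trace (w ** n) = 0 \<Longrightarrow> trace (w ** n') = 0 \<Longrightarrow> \<exists>k. w = k *m u"
proof -
  have "trace u = 0"
    using assms by (simp add: reflections_def)
  then obtain p q r where u: "u = sl p q r"
    by (rule traceless_cases)
  have pqr: "p * p + q * r = 1"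
    using assms by (simp add: reflections_def u mat2_simps) Groebner_Basis.algebra
  \<comment> \<open>As in \<open>nilpotent_cases\<close>, the kernel of \<open>N s t\<close> is
    spanned by \<open>(s, t)\<close>.\<close>
  define N where "N s t = (sl (s * t) (- s * s) (t * t) :: 'a^2^2)" for s t
  have N: "N s t \<in> nilpotents" if "s \<noteq> 0 \<or> t \<noteq> 0" for s t
    using that by (auto simp: N_def nilpotents_def mat2_simps)
  have trN: "trace (sl a b c ** N s t) = (a + a) * s * t + b * t * t - c * s * s" for a b c s t
    by (simp add: N_def mat2_simps algebra_simps)
  have trNN: "trace (N s t ** N s' t') = - ((s * t' - s' * t) * (s * t' - s' * t))" for s t s' t'
    by (simp add: N_def mat2_simps) Groebner_Basis.algebra
  show thesis
  proof (cases "q = 0")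
    case True
    have p: "p * p = 1"
      using pqr unfolding True by simp
    then have p: "p * p = 1" "p \<noteq> 0" "p + p \<noteq> 0"
      unfolding double_eq_0_iff by auto
    \<comment> \<open>The lower triangular \<open>u\<close> has the eigenvectors
      \<open>(0, 1)\<close> for \<open>- p\<close> and \<open>(p + p, r)\<close> for
      \<open>p\<close>.\<close>
    show thesis
    proof (rule that[of "N 0 1" "N (p + p) r"])
      show "trace (u ** N (p + p) r) = 0"
        unfolding u trN True by Groebner_Basis.algebra
      show "trace (u ** N 0 1) = 0"
        unfolding u trN True by simp
      show "trace (N 0 1 ** N (p + p) r) \<noteq> 0"
        using p(3) unfolding trNN by (simp only: neg_equal_0_iff_equal mult_eq_0_iff) simp
      fix w :: "'a^2^2"
      assume w: "trace w = 0" "trace (w ** N 0 1) = 0" "trace (w ** N (p + p) r) = 0"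
      obtain a b c where w': "w = sl a b c"
        using w(1) by (rule traceless_cases)
      have b: "b = 0"
        using w(2) unfolding w' trN by simp
      have "(p + p) * ((a * r - c * p) + (a * r - c * p)) = 0"
        using w(3) unfolding w' trN b by Groebner_Basis.algebra
      then have "a * r = c * p"
        using p(3) by (simp only: mult_eq_0_iff double_eq_0_iff right_minus_eq simp_thms)
      then have "c = a * p * r" "a = a * p * p"
        using p(1) by Groebner_Basis.algebra+
      then have "w = (a * p) *m u"
        unfolding w' u using b True by (simp add: mat2_simps)
      then show "\<exists>k. w = k *m u"
        by blast
    qed (use p in \<open>simp_all only: N simp_thms one_neq_zero not_False_eq_True\<close>)
  next
    case False
    then have q: "q + q \<noteq> 0"
      by (simp only: double_eq_0_iff simp_thms)
    show thesis
    \<comment> \<open>The vectors \<open>(q, 1 - p)\<close> and \<open>(q, - 1 - p)\<close> are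
      eigenvectors of \<open>u\<close> for \<open>1\<close> and \<open>-1\<close>.\<close>
    proof (rule that[of "N q (1 - p)" "N q (- 1 - p)"])
      show "trace (u ** N q (1 - p)) = 0" "trace (u ** N q (- 1 - p)) = 0"
        using pqr unfolding u trN by Groebner_Basis.algebra+
      have "q * (- 1 - p) - q * (1 - p) = - (q + q)"
        by Groebner_Basis.algebra
      then show "trace (N q (1 - p) ** N q (- 1 - p)) \<noteq> 0"
        using q unfolding trNN by (simp only: mult_eq_0_iff neg_equal_0_iff_equal simp_thms not_False_eq_True)
      fix w :: "'a^2^2"
      assume w: "trace w = 0" "trace (w ** N q (1 - p)) = 0" "trace (w ** N q (- 1 - p)) = 0"
      obtain a b c where w': "w = sl a b c"
        using w(1) by (rule traceless_cases)
      note eq = w(2,3)[unfolded w' trN]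
      define d where "d = a * q - b * p"
      have "(d + d) + (d + d) = 0"
        using eq unfolding d_def by Groebner_Basis.algebra
      then have ab: "a * q = b * p"
        by (simp only: double_eq_0_iff d_def right_minus_eq)
      have "(q + q) * (b * r - c * q) = 0"
        using eq ab pqr by Groebner_Basis.algebra
      then have "b * r = c * q"
        using q by (simp only: mult_eq_0_iff right_minus_eq simp_thms)
      with ab have "w = (b / q) *m u"
        unfolding w' u using False by (simp add: mat2_simps field_simps)
      then show "\<exists>k. w = k *m u"
        by blast
    qed (use False in \<open>simp_all only: N simp_thms not_False_eq_True\<close>)
  qed
qed

text \<open>For an involution \<open>i\<close>, the matrix \<open>a + b i\<close> then has
  determinant \<open>1\<close> and is neither scalar nor traceless. The point comes from the
  rational parametrisation of the circle, at a parameter \<open>m\<close> outside the prime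
  field.\<close>

lemma ex_circle_point:
  obtains a b :: 'a where "a * a + b * b = 1" "a \<noteq> 0" "b \<noteq> 0"
proof -
  obtain m :: 'a where m: "m \<noteq> 0" "m \<noteq> 1" "m \<noteq> -1"
    using beyond_prime_field by blast
  define s where "s = 1 + m * m"
  have s: "s \<noteq> 0"
    using minus_one_nonsquare[of m] unfolding s_def by (metis add_eq_0_iff)
  have "1 - m * m \<noteq> 0"
    using m square_eq_1_iff[of m] by auto
  moreover have "m + m \<noteq> 0"
    using m(1) by (simp only: double_eq_0_iff simp_thms)
  moreover have "(1 - m * m) * (1 - m * m) + (m + m) * (m + m) = s * s"
    unfolding s_def by Groebner_Basis.algebra
  then have "((1 - m * m) / s) * ((1 - m * m) / s) + ((m + m) / s) * ((m + m) / s) = 1"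
    using s by (simp add: add_divide_distrib[symmetric])
  ultimately show thesis
    using that s by (metis divide_eq_0_iff)
qed

text \<open>The analogue for split tori: \<open>a = m + 1/m\<close> and \<open>b = m - 1/m\<close>,
  where \<open>a^2 - b^2 = 4 = 1\<close>.\<close>

lemma ex_hyperbola_point:
  obtains a b :: 'a where "a * a - b * b = 1" "a \<noteq> 0" "b \<noteq> 0"
proof -
  obtain m :: 'a where m: "m \<noteq> 0" "m \<noteq> 1" "m \<noteq> -1"
    using beyond_prime_field by blast
  obtain k where k: "m * k = 1"
    using m(1) by (metis right_inverse)
  have "(m + k) * (m + k) - (m - k) * (m - k) = (m * k + m * k) + (m * k + m * k)"
    by Groebner_Basis.algebra
  then have "(m + k) * (m + k) - (m - k) * (m - k) = 1"
    by (simp only: double k minus_minus)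
  moreover have "m + k \<noteq> 0"
  proof
    assume "m + k = 0"
    then have "m * m = -1"
      using k by Groebner_Basis.algebra
    then show False
      using minus_one_nonsquare by blast
  qed
  moreover have "m - k \<noteq> 0"
  proof
    assume "m - k = 0"
    then have "m * m = 1"
      using k by simp
    then show False
      using m by (simp add: square_eq_1_iff)
  qed
  ultimately show thesis
    using that by blast
qed

section \<open>Distinguishing solvabilizers\<close>

abbreviation Sol_lift :: "'a^2^2 \<Rightarrow> ('a^2^2) set set" where
  "Sol_lift x \<equiv> Sol PSL2 (proj x)"

lemma Sol_lift_eqI:
  assumes "\<And>z. det z = 1 \<Longrightarrow> sol x z \<longleftrightarrow> sol y z"
  shows "Sol_lift x = Sol_lift y"
  using assms by (simp add: Sol_proj_eq_iff)

lemma Sol_lift_eqD: "Sol_lift x = Sol_lift y \<Longrightarrow> det z = 1 \<Longrightarrow> sol z x \<longleftrightarrow> sol z y"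
  unfolding Sol_proj_eq_iff sol_commute[of z] by blast

lemma Sol_lift_uminus: "Sol_lift (- x) = Sol_lift x"
  by (rule Sol_lift_eqI) (rule sol_uminus)

text \<open>The involutions $i$ such that the solvabilizer of $x$ contains the elements $a + b i$, $a, b \neq 0$, of the
  nonsplit torus centralising $i$ (see \<open>sol_nonsplit_torus_iff\<close>).\<close>

definition norm_sig :: "'a^2^2 \<Rightarrow> ('a^2^2) set" where
  "norm_sig x = {i \<in> involutions. x ** i = i ** x \<or> x ** i = - (i ** x)}"

text \<open>\<open>norm_sig\<close> is empty on split and on noncentral unipotent elements; this
  second invariant tells those apart.\<close>

definition unip_sig :: "'a^2^2 \<Rightarrow> ('a^2^2) set" where
  "unip_sig x = {n \<in> nilpotents. sol (mat 1 + n) x}"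

lemma involutions_nonzero: "i \<in> involutions \<Longrightarrow> i \<noteq> 0"
  using SL2_nonzero by (simp add: involutions_def)

lemma norm_sig_torus:
  assumes "i \<in> norm_sig (mat s + t *m v)" "s \<noteq> 0" "t \<noteq> 0" "v \<noteq> 0" "trace v = 0"
  obtains k where "i = k *m v"
proof -
  have i: "i \<noteq> 0" "trace i = 0" and norm: "(mat s + t *m v) ** i = i ** (mat s + t *m v)
      \<or> (mat s + t *m v) ** i = - (i ** (mat s + t *m v))"
    using assms(1) involutions_nonzero by (auto simp: norm_sig_def involutions_def)
  have "trace (mat s + t *m v) \<noteq> 0"
    using assms(2,5) unfolding trace_mat_add by simp
  then have "(mat s + t *m v) ** i = i ** (mat s + t *m v)"
    using norm anticommute_iff[OF i] by blast
  then have "t *m (v ** i) = t *m (i ** v)"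
    by (simp add: matrix_add_ldistrib matrix_add_rdistrib mat_mult_scalar)
  then have "v ** i = i ** v"
    by (rule smult_cancel[OF assms(3)])
  then show thesis
    using traceless_commute[OF assms(4,5) i(2)] that by metis
qed

lemma norm_sig_one: "norm_sig (mat 1) = involutions"
  by (auto simp: norm_sig_def)

lemma norm_sig_unipotent:
  assumes "m \<in> nilpotents"
  shows "norm_sig (mat 1 + m) = {}"
proof (rule equals0I)
  fix i assume i: "i \<in> norm_sig (mat 1 + m)"
  have m: "m \<noteq> 0" "trace m = 0" "det m = 0"
    using assms by (auto simp: nilpotents_def)
  obtain k where "i = k *m m"
    using norm_sig_torus[of i 1 1 m] i m by auto
  then show False
    using i m by (simp add: norm_sig_def involutions_def)
qed

lemma norm_sig_split:
  assumes "u \<in> reflections" "s \<noteq> 0" "t \<noteq> 0"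
  shows "norm_sig (mat s + t *m u) = {}"
proof (rule equals0I)
  fix i assume i: "i \<in> norm_sig (mat s + t *m u)"
  have u: "u \<noteq> 0" "trace u = 0" "det u = -1"
    using assms by (auto simp: reflections_def mat2_simps)
  obtain k where "i = k *m u"
    using norm_sig_torus[OF i assms(2,3) u(1,2)] by blast
  then have "- (k * k) = 1"
    using i u by (simp add: norm_sig_def involutions_def)
  then have "k * k = - 1"
    by (metis minus_minus)
  then show False
    using minus_one_nonsquare by blast
qed

lemma norm_sig_nonsplit:
  assumes "v \<in> involutions" "s \<noteq> 0" "t \<noteq> 0"
  shows "norm_sig (mat s + t *m v) = {v, - v}"
proof (intro equalityI subsetI)
  have v: "v \<noteq> 0" "trace v = 0" "det v = 1"
    using assms involutions_nonzero by (auto simp: involutions_def)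
  fix i assume i: "i \<in> norm_sig (mat s + t *m v)"
  obtain k where "i = k *m v"
    using norm_sig_torus[OF i assms(2,3) v(1,2)] by blast
  moreover have "det i = det v" "det v \<noteq> 0"
    using i v by (simp_all add: norm_sig_def involutions_def)
  ultimately show "i \<in> {v, - v}"
    using proportional_same_det by blast
next
  fix i assume "i \<in> {v, - v}"
  moreover have "- v \<in> involutions"
    using assms(1) trace_sub[of 0 v] by (simp add: involutions_def det_uminus_2)
  ultimately show "i \<in> norm_sig (mat s + t *m v)"
    using assms(1) unfolding norm_sig_def
    by (auto simp: matrix_add_ldistrib matrix_add_rdistrib mat_mult_scalar matrix_uminus)
qed

lemma involutions_commute:
  assumes "v \<in> involutions" "w \<in> involutions" "w ** v = v ** w"
  shows "w = v \<or> w = - v"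
proof -
  have v: "v \<noteq> 0" "trace v = 0" "trace w = 0" "det w = det v" "det v \<noteq> 0"
    using assms involutions_nonzero by (auto simp: involutions_def)
  obtain k where "w = k *m v"
    using traceless_commute[OF v(1-3) assms(3)] by blast
  then show ?thesis
    using proportional_same_det v by blast
qed

text \<open>An anticommuting \<open>w\<close> is easy to find, but its determinant may be minus a
  square. Left multiplication by \<open>1 + v\<close>, of determinant \<open>2 = -1\<close>, then
  corrects the sign and preserves anticommuting.\<close>

lemma ex_anticommuting_involution:
  assumes "v \<in> involutions"
  obtains j where "j \<in> involutions" "quat v j"
proof -
  have tr: "trace v = 0" and det: "det v = 1"
    using assms by (auto simp: involutions_def)
  have nz: "v \<noteq> 0"
    using assms by (rule involutions_nonzero)
  obtain p q r where v: "v = sl p q r"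
    using tr by (rule traceless_cases)
  have pqr: "p * p + q * r = -1"
    using det by (simp add: v mat2_simps) Groebner_Basis.algebra
  \<comment> \<open>Orthogonal to \<open>v\<close> for the trace form; its determinant
    \<open>q * r = - 1 - p * p\<close> is nonzero.\<close>
  define w where "w = sl 0 q (- r)"
  have detw: "det w = q * r"
    by (simp add: w_def mat2_simps)
  have nzw: "q * r \<noteq> 0"
    using pqr minus_one_nonsquare[of p] by auto
  have wv: "w ** v = - (v ** w)"
    using anticommute_iff[OF nz tr] by (simp add: w_def v mat2_simps)
  have "\<exists>w' s. w' ** v = - (v ** w') \<and> det w' = s * s \<and> s \<noteq> 0"
  proof -
    obtain s where s: "q * r = s * s \<or> q * r = - (s * s)"
      using square_or_minus_square by blast
    then have s0: "s \<noteq> 0"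
      using nzw by auto
    from s show ?thesis
    proof
      assume "q * r = s * s"
      then show ?thesis
        using wv detw s0 by auto
    next
      assume qr: "q * r = - (s * s)"
      have "(w + v ** w) ** v = - (v ** (w + v ** w))"
        using wv by (simp add: matrix_add_ldistrib matrix_add_rdistrib matrix_mul_assoc[symmetric] matrix_uminus)
      moreover have "det (w + v ** w) = s * s"
      proof -
        have "det (w + v ** w) = det ((mat 1 + v) ** w)"
          by (simp add: matrix_add_rdistrib)
        also have "\<dots> = s * s"
          using det_mat_add[OF tr, of 1] det detw qr by (simp add: det_mul two)
        finally show ?thesis .
      qed
      ultimately show ?thesis
        using s0 by blast
    qed
  qed
  then obtain w' s where w': "w' ** v = - (v ** w')" "det w' = s * s" "s \<noteq> 0"
    by blast
  define j where "j = (1 / s) *m w'"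
  have "det j = 1"
    using w' by (simp add: j_def)
  moreover have "j ** v = - (v ** j)"
    using w'(1) by (simp add: j_def)
  then have "quat j v"
    using calculation det by (simp add: quat_def)
  then have "quat v j"
    by (rule quat_swap)
  moreover have "trace j = 0"
    using quat_trace(2)[OF \<open>quat v j\<close>] .
  ultimately show thesis
    using that by (simp add: involutions_def)
qed

text \<open>In the plane of the orthogonal pair \<open>v\<close>, \<open>j\<close>, a circle point
  with both coordinates nonzero is neither parallel nor orthogonal to \<open>v\<close>.\<close>

lemma ex_involution_outside_norm_sig:
  assumes q: "quat v j"
  obtains i a b where "i \<in> involutions" "i \<notin> norm_sig v" "i = a *m v + b *m j"
proof -
  obtain a b :: 'a where ab: "a * a + b * b = 1" "a \<noteq> 0" "b \<noteq> 0"
    by (rule ex_circle_point)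
  note tr = quat_trace[OF q] and det = quat_det[OF q]
  have v: "v \<noteq> 0"
    using det SL2_nonzero by blast
  let ?i = "a *m v + b *m j"
  have tri: "trace ?i = 0"
    using tr by (simp add: trace_add)
  have deti: "det ?i = 1"
    using det_traceless_add[of "a *m v" "b *m j"] tr det trace_quat_mult[OF q] ab(1) by simp
  have jv: "trace (j ** v) = 0"
    using trace_quat_mult[OF q] trace_mul_sym[of v j] by simp
  have "trace (?i ** v) \<noteq> 0"
    using trace_square[OF tr(1)] det jv ab by (simp add: matrix_add_rdistrib trace_add)
  then have "?i ** v \<noteq> - (v ** ?i)"
    using anticommute_iff[OF v tr(1)] by blast
  moreover have "v ** ?i \<noteq> ?i ** v"
  proof
    assume "v ** ?i = ?i ** v"
    then obtain k where "?i = k *m v"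
      using traceless_commute[OF v tr(1) tri] by metis
    then have "trace (?i ** j) = trace ((k *m v) ** j)"
      by simp
    then show False
      using trace_square[OF tr(2)] det trace_quat_mult[OF q] ab by (simp add: matrix_add_rdistrib trace_add)
  qed
  moreover have "?i ** v = - (v ** ?i)" if "v ** ?i = - (?i ** v)"
    by (simp only: that minus_minus)
  ultimately have "?i \<notin> norm_sig v"
    unfolding norm_sig_def by blast
  then show thesis
    using that tri deti by (simp add: involutions_def)
qed

text \<open>As \<open>v\<close> is in its own signature, equality makes \<open>v\<close> and
  \<open>w\<close> commute, so that \<open>w\<close> is \<open>v\<close> or \<open>- v\<close>, or
  anticommute. In the latter case some combination of \<open>w\<close> and \<open>w v\<close>
  anticommutes with \<open>v\<close> but lies outside \<open>norm_sig w\<close>.\<close>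

lemma norm_sig_involution_inj:
  assumes v: "v \<in> involutions" and w: "w \<in> involutions" and eq: "norm_sig v = norm_sig w"
  shows "w = v \<or> w = - v"
proof (rule ccontr)
  assume neq: "\<not> ?thesis"
  have "v \<in> norm_sig v"
    using v by (simp add: norm_sig_def)
  then have "v \<in> norm_sig w"
    using eq by (simp only:)
  then have "w ** v = v ** w \<or> w ** v = - (v ** w)"
    by (simp add: norm_sig_def)
  then have "w ** v = - (v ** w)"
    using involutions_commute[OF v w] neq by blast
  then have q: "quat w v"
    using v w by (simp add: quat_def involutions_def)
  have "quat w (w ** v)"
    by (rule quat_swap[OF quat_rotate[OF q]])
  then obtain i a b where i: "i \<in> involutions" "i \<notin> norm_sig w" "i = a *m w + b *m (w ** v)"
    using ex_involution_outside_norm_sig by blast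
  have vw: "v ** w = - (w ** v)"
    by (rule quat_anticommute(2)[OF q])
  have "v ** (w ** v) = w"
    by (rule quat_mult(2)[OF q])
  moreover have "w ** v ** v = - w"
    by (rule quat_mult(4)[OF q])
  ultimately have "v ** i = - (i ** v)"
    unfolding i(3) by (simp add: matrix_add_ldistrib matrix_add_rdistrib vw)
  then have "i \<in> norm_sig v"
    using i(1) by (simp add: norm_sig_def)
  then show False
    using eq i(2) by simp
qed

lemma unip_sig_unipotent:
  assumes "m \<in> nilpotents"
  shows "unip_sig (mat 1 + m) = {n \<in> nilpotents. trace (m ** n) \<in> {0, 1, -1}}"
  using sol_unipotents_iff[OF assms] unfolding unip_sig_def sol_commute[of _ "mat 1 + m"] by blast

lemma unip_sig_split:
  assumes "u \<in> reflections" "s \<noteq> 0" "t \<noteq> 0" "det (mat s + t *m u) = 1"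
  shows "unip_sig (mat s + t *m u) = {n \<in> nilpotents. trace (u ** n) = 0}"
proof -
  have "trace u = 0" "det u \<noteq> 0"
    using assms by (auto simp: reflections_def)
  from sol_torus_unipotent_iff[OF this refl assms(2-4)] show ?thesis
    unfolding unip_sig_def sol_commute[of _ "mat s + t *m u"] nilpotents_def by blast
qed

text \<open>If \<open>tr(m m')\<close> were nonzero, some multiple of \<open>m\<close> would have
  trace \<open>0\<close> against \<open>m\<close> and a value outside the prime field against
  \<open>m'\<close>. So \<open>m' = k m\<close>, and a nilpotent with trace \<open>1\<close> against
  \<open>m\<close> puts \<open>k\<close> in the prime field.\<close>

lemma unip_sig_unipotent_inj:
  assumes m: "m \<in> nilpotents" and m': "m' \<in> nilpotents"
    and eq: "unip_sig (mat 1 + m) = unip_sig (mat 1 + m')"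
  shows "m' = m \<or> m' = - m"
proof -
  have n: "m \<noteq> 0" "trace m = 0" "det m = 0" "m' \<noteq> 0" "trace m' = 0" "det m' = 0"
    using m m' by (auto simp: nilpotents_def)
  have mm: "trace (m ** m) = 0"
    using nilpotent_square[OF n(2,3)] by simp
  obtain b :: 'a where b: "b \<noteq> 0" "b \<noteq> 1" "b \<noteq> -1"
    using beyond_prime_field by blast
  have sig: "trace (m ** k) \<in> {0, 1, -1} \<longleftrightarrow> trace (m' ** k) \<in> {0, 1, -1}" if "k \<in> nilpotents" for k
    using eq that unfolding unip_sig_unipotent[OF m] unip_sig_unipotent[OF m'] by blast
  have "trace (m ** m') = 0"
  proof (rule ccontr)
    assume t: "trace (m ** m') \<noteq> 0"
    let ?c = "b / trace (m ** m')"
    have "?c *m m \<in> nilpotents"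
      using m t b by (simp add: smult_nilpotents)
    moreover have "trace (m ** (?c *m m)) = 0"
      using mm by simp
    moreover have "trace (m' ** (?c *m m)) = b"
      using t trace_mul_sym[of m m'] by simp
    ultimately show False
      using sig[of "?c *m m"] b by auto
  qed
  then obtain k where k: "k \<noteq> 0" "m' = k *m m"
    using nilpotent_orthogonal[OF n] by blast
  obtain l where l: "l \<in> nilpotents" "trace (m ** l) = 1"
    using ex_nilpotent_trace[OF m, of 1] by auto
  then have "k \<in> {0, 1, -1}"
    using sig[OF l(1)] by (simp add: k)
  then show ?thesis
    using k by auto
qed

text \<open>The right-hand set is closed under nonzero scaling, so equality would make the
  nilpotents \<open>n1\<close>, \<open>n2\<close> of \<open>u\<close> orthogonal to
  \<open>m\<close>. Then \<open>n1\<close> is a multiple of \<open>m\<close>, contradicting that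
  \<open>tr(n1 n2)\<close> is nonzero.\<close>

lemma unip_sig_unipotent_neq_split:
  assumes m: "m \<in> nilpotents" and u: "u \<in> reflections"
  shows "{n \<in> nilpotents. trace (m ** n) \<in> {0, 1, -1}} \<noteq> {n \<in> nilpotents. trace (u ** n) = 0}"
proof
  assume eq: "{n \<in> nilpotents. trace (m ** n) \<in> {0, 1, -1}} = {n \<in> nilpotents. trace (u ** n) = 0}"
  obtain b :: 'a where b: "b \<noteq> 0" "b \<noteq> 1" "b \<noteq> -1"
    using beyond_prime_field by blast
  have zero: "trace (m ** n) = 0" if n: "n \<in> nilpotents" "trace (u ** n) = 0" for n
  proof (rule ccontr)
    assume t: "trace (m ** n) \<noteq> 0"
    let ?n = "(b / trace (m ** n)) *m n"
    have "?n \<in> nilpotents" "trace (u ** ?n) = 0"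
      using n t b by (simp_all add: smult_nilpotents)
    then have "trace (m ** ?n) \<in> {0, 1, -1}"
      using eq by blast
    then show False
      using t b by simp
  qed
  have n: "m \<noteq> 0" "trace m = 0" "det m = 0"
    using m by (auto simp: nilpotents_def)
  obtain n1 n2 where n12: "n1 \<in> nilpotents" "n2 \<in> nilpotents" "trace (u ** n1) = 0" "trace (u ** n2) = 0"
      "trace (n1 ** n2) \<noteq> 0"
    using reflection_nilpotents[OF u] by metis
  have "trace (m ** n1) = 0" "trace (m ** n2) = 0"
    using zero n12 by blast+
  moreover obtain k where "n1 = k *m m"
    using nilpotent_orthogonal[OF n, of n1] n12(1) calculation(1) unfolding nilpotents_def by blast
  ultimately show False
    using n12(5) by simp
qed

lemma unip_sig_split_inj:
  assumes u: "u \<in> reflections" and u': "u' \<in> reflections"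
    and eq: "{n \<in> nilpotents. trace (u ** n) = 0} = {n \<in> nilpotents. trace (u' ** n) = 0}"
  shows "u' = u \<or> u' = - u"
proof -
  obtain n1 n2 where n12: "n1 \<in> nilpotents" "n2 \<in> nilpotents" "trace (u ** n1) = 0" "trace (u ** n2) = 0"
    and span: "\<And>w. trace w = 0 \<Longrightarrow> trace (w ** n1) = 0 \<Longrightarrow> trace (w ** n2) = 0 \<Longrightarrow> \<exists>k. w = k *m u"
    using reflection_nilpotents[OF u] by metis
  have "trace (u' ** n1) = 0" "trace (u' ** n2) = 0"
    using eq n12 by blast+
  moreover have tr: "trace u' = 0" "det u' = det u" "det u \<noteq> 0"
    using u u' by (auto simp: reflections_def)
  ultimately obtain k where "u' = k *m u"
    using span by blast
  then show ?thesis
    using proportional_same_det tr by blast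
qed

lemma Sol_lift_eq_imp_norm_sig:
  assumes "Sol_lift x = Sol_lift y" "det x = 1" "det y = 1"
  shows "norm_sig x = norm_sig y"
proof -
  obtain a b :: 'a where ab: "a * a + b * b = 1" "a \<noteq> 0" "b \<noteq> 0"
    by (rule ex_circle_point)
  have iff: "z ** i = i ** z \<or> z ** i = - (i ** z) \<longleftrightarrow> sol (mat a + b *m i) z"
    if "i \<in> involutions" "det z = 1" for i z
  proof -
    have i: "trace i = 0" "det i = 1"
      using that by (auto simp: involutions_def)
    then have "det (mat a + b *m i) = 1"
      using ab(1) by (simp add: det_mat_add)
    from sol_nonsplit_torus_iff[OF i refl ab(2,3) this that(2)] show ?thesis
      by (rule sym)
  qed
  have det: "det (mat a + b *m i) = 1" if "i \<in> involutions" for i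
    using that ab(1) by (simp add: det_mat_add involutions_def)
  have "i \<in> norm_sig x \<longleftrightarrow> i \<in> norm_sig y" for i
    unfolding norm_sig_def mem_Collect_eq
    using iff[of i x] iff[of i y] Sol_lift_eqD[OF assms(1) det[of i]] assms(2,3) by blast
  then show ?thesis
    by blast
qed

lemma Sol_lift_eq_imp_unip_sig:
  assumes "Sol_lift x = Sol_lift y"
  shows "unip_sig x = unip_sig y"
  using Sol_lift_eqD[OF assms unipotent(1)] unfolding unip_sig_def by blast

text \<open>\<open>norm_sig\<close> contains all involutions for the identity, is
  \<open>{v, - v}\<close> for nonsplit elements, empty for unipotent and split ones, and for an
  involution none of these. \<open>unip_sig\<close> separates unipotent from split elements.\<close>

lemma card_Solv_PSL2: "2 * card (Solv (PSL2 :: ('a^2^2) set monoid)) + CARD('a) = 4 * (CARD('a) * CARD('a)) + 1"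
proof -
  \<comment> \<open>One representative per torus suffices: by \<open>sol_torus_iff\<close> the
    nonzero coefficients do not matter, and \<open>(a, b)\<close>, \<open>(c, d)\<close> fix a
    choice.\<close>
  obtain a b :: 'a where ab: "a * a + b * b = 1" "a \<noteq> 0" "b \<noteq> 0"
    by (rule ex_circle_point)
  obtain c d :: 'a where cd: "c * c - d * d = 1" "c \<noteq> 0" "d \<noteq> 0"
    by (rule ex_hyperbola_point)
  define unip where "unip n = Sol_lift (mat 1 + n)" for n
  define invol where "invol v = Sol_lift v" for v
  define nonsplit where "nonsplit v = Sol_lift (mat a + b *m v)" for v
  define split where "split u = Sol_lift (mat c + d *m u)" for u
  let ?one = "Sol_lift (mat 1)"
  have Inv: "trace v = 0" "det v = 1" "det v \<noteq> 0" if "v \<in> involutions" for v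
    using that by (auto simp: involutions_def)
  have Ref: "trace u = 0" "det u = -1" "det u \<noteq> 0" if "u \<in> reflections" for u
    using that by (auto simp: reflections_def)
  have Nil: "n \<noteq> 0" "trace n = 0" "det n = 0" if "n \<in> nilpotents" for n
    using that by (auto simp: nilpotents_def)
  have det_nonsplit: "det (mat a + b *m v) = 1" if "v \<in> involutions" for v
    using Inv[OF that] ab(1) by (simp add: det_mat_add)
  have det_split: "det (mat c + d *m u) = 1" if "u \<in> reflections" for u
    using Ref[OF that] cd(1) by (simp add: det_mat_add)
  have trace_uminus: "trace (- v) = - trace v" for v :: "'a^2^2"
    using trace_sub[of 0 v] by simp

  have split_eq: "Sol_lift (mat s + t *m u) = split u"
    if u: "u \<in> reflections" and st: "s \<noteq> 0" "t \<noteq> 0" "det (mat s + t *m u) = 1" for s t u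
    unfolding split_def
    by (rule Sol_lift_eqI)
      (simp only: sol_torus_iff[OF Ref(1,3)[OF u] refl st] sol_torus_iff[OF Ref(1,3)[OF u] refl cd(2,3) det_split[OF u]])
  have nonsplit_eq: "Sol_lift (mat s + t *m v) = nonsplit v"
    if v: "v \<in> involutions" and st: "s \<noteq> 0" "t \<noteq> 0" "det (mat s + t *m v) = 1" for s t v
    unfolding nonsplit_def
    by (rule Sol_lift_eqI)
      (simp only: sol_torus_iff[OF Inv(1,3)[OF v] refl st] sol_torus_iff[OF Inv(1,3)[OF v] refl ab(2,3) det_nonsplit[OF v]])
  have unip_uminus: "unip (- n) = unip n" if "n \<in> nilpotents" for n
    unfolding unip_def by (rule Sol_lift_eqI) (simp add: sol_unipotent_uminus[OF that])

  have Solv: "Solv (PSL2 :: ('a^2^2) set monoid) = insert ?one (unip ` nilpotents \<union> (invol ` involutions \<union> (nonsplit ` involutions \<union> split ` reflections)))"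
    (is "_ = ?R")
  proof (intro equalityI subsetI)
    fix X assume "X \<in> Solv (PSL2 :: ('a^2^2) set monoid)"
    then obtain x where x: "det x = 1" and X: "X = Sol_lift x"
      by (auto simp: Solv_PSL2)
    obtain s v where x_eq: "x = mat s + v" and v: "trace v = 0"
      by (rule traceless_part)
    have sv: "s * s + det v = 1"
      using x det_mat_add[OF v] x_eq by simp
    show "X \<in> ?R"
    proof (cases "det v = 0")
      case True
      then have s: "s = 1 \<or> s = -1"
        using sv by (simp add: square_eq_1_iff)
      obtain w where w: "w = v \<or> w = - v" "x = mat 1 + w \<or> x = - (mat 1 + w)"
      proof -
        have "x = - (mat 1 + (- v))" if "s = -1"
          unfolding x_eq that by (cases v rule: mat2_cases) (simp add: mat2_simps)
        then show thesis
          using s that[of v] that[of "- v"] x_eq by auto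
      qed
      have X': "X = Sol_lift (mat 1 + w)"
        using w(2) Sol_lift_uminus unfolding X by blast
      show ?thesis
      proof (cases "w = 0")
        case True
        then show ?thesis
          using X' by simp
      next
        case False
        then have "w \<in> nilpotents"
          using w(1) v \<open>det v = 0\<close> trace_uminus by (auto simp: nilpotents_def det_uminus_2)
        then show ?thesis
          using X' unfolding unip_def by blast
      qed
    next
      case False
      obtain t where t: "det v = t * t \<or> det v = - (t * t)"
        using square_or_minus_square by blast
      then have t0: "t \<noteq> 0"
        using False by auto
      define w where "w = (1 / t) *m v"
      have x_w: "x = mat s + t *m w"
        using t0 by (simp add: w_def x_eq)
      have tr_w: "trace w = 0"
        using v by (simp add: w_def)
      from t show ?thesis
      proof
        assume "det v = t * t"
        then have w: "w \<in> involutions"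
          using t0 tr_w by (simp add: involutions_def w_def)
        show ?thesis
        proof (cases "s = 0")
          case True
          then have "t = 1 \<or> t = -1"
            using sv \<open>det v = t * t\<close> by (simp add: square_eq_1_iff)
          then have "x = w \<or> x = - w"
            using x_w True by auto
          then have "X = invol w"
            unfolding X invol_def using Sol_lift_uminus by blast
          then show ?thesis
            using w by blast
        next
          case False
          then have "X = nonsplit w"
            using nonsplit_eq[OF w False t0] x x_w X by simp
          then show ?thesis
            using w by blast
        qed
      next
        assume dv: "det v = - (t * t)"
        then have w: "w \<in> reflections"
          using t0 tr_w by (simp add: reflections_def w_def)
        \<comment> \<open>Split tori contain no involutions: trace zero would give
          \<open>t * t = -1\<close>.\<close>
        have "s \<noteq> 0"
        proof
          assume "s = 0"
          then have "t * t = -1"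
            using sv dv by (metis add_0 minus_minus mult_zero_left)
          then show False
            using minus_one_nonsquare by blast
        qed
        then have "X = split w"
          using split_eq[OF w _ t0] x x_w X by simp
        then show ?thesis
          using w by blast
      qed
    qed
  next
    fix X assume "X \<in> ?R"
    then show "X \<in> Solv (PSL2 :: ('a^2^2) set monoid)"
      unfolding Solv_PSL2 unip_def invol_def nonsplit_def split_def
      using unipotent(1) Inv(2) det_nonsplit det_split by (auto intro!: imageI)
  qed

  have sig: "norm_sig x = norm_sig y" "unip_sig x = unip_sig y"
    if "Sol_lift x = Sol_lift y" "det x = 1" "det y = 1" for x y
    using Sol_lift_eq_imp_norm_sig[OF that] Sol_lift_eq_imp_unip_sig[OF that(1)] .
  have uminus_neq: "- v \<noteq> v" if "v \<noteq> 0" for v :: "'a^2^2"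
    using that matrix_minus_eq_self by blast
  have uminus_Inv: "- v \<in> involutions" if "v \<in> involutions" for v
    using that trace_uminus by (simp add: involutions_def det_uminus_2)
  have uminus_Ref: "- v \<in> reflections" if "v \<in> reflections" for v
    using that trace_uminus by (simp add: reflections_def det_uminus_2)
  have nz_Inv: "v \<noteq> 0" if "v \<in> involutions" for v
    using that by (rule involutions_nonzero)
  have nz_Ref: "v \<noteq> 0" if "v \<in> reflections" for v
    using Ref(3)[OF that] by (auto simp: mat2_simps)
  have uminus_smult: "t *m (- v) = (- t) *m v" for t and v :: "'a^2^2"
    by simp

  have card_unip: "card nilpotents = 2 * card (unip ` nilpotents)"
  proof (rule card_image_two_to_one)
    show "unip v = unip w \<longleftrightarrow> w = v \<or> w = - v" if vw: "v \<in> nilpotents" "w \<in> nilpotents" for v w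
    proof
      assume "unip v = unip w"
      then show "w = v \<or> w = - v"
        using unip_sig_unipotent_inj[OF vw] Sol_lift_eq_imp_unip_sig unfolding unip_def by blast
    qed (use unip_uminus[OF vw(1)] in auto)
  qed (use Nil uminus_neq uminus_nilpotents in simp_all)
  have card_invol: "card involutions = 2 * card (invol ` involutions)"
  proof (rule card_image_two_to_one)
    show "invol v = invol w \<longleftrightarrow> w = v \<or> w = - v" if vw: "v \<in> involutions" "w \<in> involutions" for v w
    proof
      assume "invol v = invol w"
      then show "w = v \<or> w = - v"
        using norm_sig_involution_inj[OF vw] sig(1) Inv vw unfolding invol_def by blast
    qed (use Sol_lift_uminus in \<open>auto simp: invol_def\<close>)
  qed (use nz_Inv uminus_neq uminus_Inv in simp_all)
  have card_nonsplit: "card involutions = 2 * card (nonsplit ` involutions)"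
  proof (rule card_image_two_to_one)
    show "nonsplit v = nonsplit w \<longleftrightarrow> w = v \<or> w = - v" if vw: "v \<in> involutions" "w \<in> involutions" for v w
    proof
      assume "nonsplit v = nonsplit w"
      then have "norm_sig (mat a + b *m v) = norm_sig (mat a + b *m w)"
        using sig(1) det_nonsplit vw unfolding nonsplit_def by blast
      then have "{v, - v} = {w, - w}"
        unfolding norm_sig_nonsplit[OF vw(1) ab(2,3)] norm_sig_nonsplit[OF vw(2) ab(2,3)] .
      then show "w = v \<or> w = - v"
        by blast
    next
      assume w: "w = v \<or> w = - v"
      \<comment> \<open>Negating \<open>v\<close> amounts to negating the coefficient
        \<open>b\<close>, which \<open>nonsplit_eq\<close> ignores.\<close>
      have "nonsplit (- v) = nonsplit v"
        using nonsplit_eq[OF vw(1) ab(2), of "- b"] det_nonsplit[OF uminus_Inv[OF vw(1)]] ab(3)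
        unfolding nonsplit_def[of "- v"] uminus_smult by simp
      then show "nonsplit v = nonsplit w"
        using w by auto
    qed
  qed (use nz_Inv uminus_neq uminus_Inv in simp_all)
  have card_split: "card reflections = 2 * card (split ` reflections)"
  proof (rule card_image_two_to_one)
    show "split v = split w \<longleftrightarrow> w = v \<or> w = - v" if vw: "v \<in> reflections" "w \<in> reflections" for v w
    proof
      assume "split v = split w"
      then have "unip_sig (mat c + d *m v) = unip_sig (mat c + d *m w)"
        using Sol_lift_eq_imp_unip_sig unfolding split_def by blast
      then show "w = v \<or> w = - v"
        unfolding unip_sig_split[OF vw(1) cd(2,3) det_split[OF vw(1)]] unip_sig_split[OF vw(2) cd(2,3) det_split[OF vw(2)]]
        by (rule unip_sig_split_inj[OF vw])
    next
      assume w: "w = v \<or> w = - v"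
      have "split (- v) = split v"
        using split_eq[OF vw(1) cd(2), of "- d"] det_split[OF uminus_Ref[OF vw(1)]] cd(3)
        unfolding split_def[of "- v"] uminus_smult by simp
      then show "split v = split w"
        using w by auto
    qed
  qed (use nz_Ref uminus_neq uminus_Ref in simp_all)

  have det_one: "det (mat 1 :: 'a^2^2) = 1"
    by simp
  obtain j0 where j0: "j0 \<in> involutions"
    using that[of "sl 0 1 (-1)"] by (simp add: involutions_def mat2_simps)
  have one_unip: "?one \<noteq> unip n" if n: "n \<in> nilpotents" for n
    using sig(1)[OF _ det_one unipotent(1)[OF n]] j0
    unfolding unip_def norm_sig_one norm_sig_unipotent[OF n] by blast
  have one_split: "?one \<noteq> split u" if u: "u \<in> reflections" for u
    using sig(1)[OF _ det_one det_split[OF u]] j0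
    unfolding split_def norm_sig_one norm_sig_split[OF u cd(2,3)] by blast
  have one_invol: "?one \<noteq> invol v" if v: "v \<in> involutions" for v
  proof
    assume "?one = invol v"
    then have "norm_sig v = involutions"
      using sig(1)[OF _ det_one Inv(2)[OF v]] unfolding invol_def norm_sig_one by blast
    moreover obtain j where "quat v j"
      using ex_anticommuting_involution[OF v] by blast
    ultimately show False
      using ex_involution_outside_norm_sig by metis
  qed
  \<comment> \<open>The signature of \<open>x\<close> contains an involution \<open>y\<close>,
    namely \<open>x\<close> itself or, for \<open>x = 1\<close>, the given \<open>v\<close>, and
    also a \<open>j\<close> anticommuting with \<open>y\<close>. These are not proportional, so
    \<open>{v, - v}\<close> cannot hold both.\<close>
  have sig_nonsplit_neq: "norm_sig x \<noteq> {v, - v}" if v: "v \<in> involutions" and x: "x = mat 1 \<or> x \<in> involutions" for x v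
  proof
    assume eq: "norm_sig x = {v, - v}"
    have "v \<in> norm_sig x"
      unfolding eq by simp
    define y where "y = (if x = mat 1 then v else x)"
    have y: "y \<in> involutions" "y \<in> norm_sig x"
      using v x \<open>v \<in> norm_sig x\<close> by (auto simp: y_def norm_sig_def)
    obtain j where j: "j \<in> involutions" "quat y j"
      using ex_anticommuting_involution[OF y(1)] by blast
    have "x ** j = j ** x \<or> x ** j = - (j ** x)"
      using j(2) unfolding y_def by (auto simp: quat_def split: if_splits)
    then have "j \<in> norm_sig x"
      using j(1) by (simp add: norm_sig_def)
    then have "j = 1 *m y \<or> j = (-1) *m y"
      using y(2) unfolding eq by auto
    then show False
      using quat_not_proportional[OF j(2)] by blast
  qed
  have one_nonsplit: "?one \<noteq> nonsplit v" if v: "v \<in> involutions" for v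
    using sig(1)[OF _ det_one det_nonsplit[OF v]] sig_nonsplit_neq[OF v, of "mat 1"]
    unfolding nonsplit_def norm_sig_nonsplit[OF v ab(2,3)] by blast
  have invol_nonsplit: "invol v \<noteq> nonsplit w" if v: "v \<in> involutions" and w: "w \<in> involutions" for v w
    using sig(1)[OF _ Inv(2)[OF v] det_nonsplit[OF w]] sig_nonsplit_neq[OF w, of v] v
    unfolding invol_def nonsplit_def norm_sig_nonsplit[OF w ab(2,3)] by blast
  have self: "v \<in> norm_sig v" if "v \<in> involutions" for v
    using that by (simp add: norm_sig_def)
  have unip_invol: "unip n \<noteq> invol v" if n: "n \<in> nilpotents" and v: "v \<in> involutions" for n v
    using sig(1)[OF _ unipotent(1)[OF n] Inv(2)[OF v]] self[OF v]
    unfolding unip_def invol_def norm_sig_unipotent[OF n] by blast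
  have unip_nonsplit: "unip n \<noteq> nonsplit v" if n: "n \<in> nilpotents" and v: "v \<in> involutions" for n v
    using sig(1)[OF _ unipotent(1)[OF n] det_nonsplit[OF v]]
    unfolding unip_def nonsplit_def norm_sig_unipotent[OF n] norm_sig_nonsplit[OF v ab(2,3)] by blast
  have unip_split: "unip n \<noteq> split u" if n: "n \<in> nilpotents" and u: "u \<in> reflections" for n u
    using sig(2)[OF _ unipotent(1)[OF n] det_split[OF u]] unip_sig_unipotent_neq_split[OF n u]
    unfolding unip_def split_def unip_sig_unipotent[OF n] unip_sig_split[OF u cd(2,3) det_split[OF u]] by blast
  have invol_split: "invol v \<noteq> split u" if v: "v \<in> involutions" and u: "u \<in> reflections" for v u
    using sig(1)[OF _ Inv(2)[OF v] det_split[OF u]] self[OF v]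
    unfolding invol_def split_def norm_sig_split[OF u cd(2,3)] by blast
  have nonsplit_split: "nonsplit v \<noteq> split u" if v: "v \<in> involutions" and u: "u \<in> reflections" for v u
    using sig(1)[OF _ det_nonsplit[OF v] det_split[OF u]]
    unfolding nonsplit_def split_def norm_sig_split[OF u cd(2,3)] norm_sig_nonsplit[OF v ab(2,3)] by blast

  have "card (Solv (PSL2 :: ('a^2^2) set monoid)) = 1 + (card (unip ` nilpotents)
      + (card (invol ` involutions) + (card (nonsplit ` involutions) + card (split ` reflections))))"
  proof -
    have "?one \<notin> unip ` nilpotents \<union> (invol ` involutions \<union> (nonsplit ` involutions \<union> split ` reflections))"
      using one_unip one_invol one_nonsplit one_split by blast
    moreover have "unip ` nilpotents \<inter> (invol ` involutions \<union> (nonsplit ` involutions \<union> split ` reflections)) = {}"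
      using unip_invol unip_nonsplit unip_split by blast
    moreover have "invol ` involutions \<inter> (nonsplit ` involutions \<union> split ` reflections) = {}"
      using invol_nonsplit invol_split by blast
    moreover have "nonsplit ` involutions \<inter> split ` reflections = {}"
      using nonsplit_split by blast
    ultimately show ?thesis
      unfolding Solv by (simp add: card_Un_disjoint)
  qed
  \<comment> \<open>Twice the sum is \<open>2 + (q^2 - 1) + 2 * (q^2 - q) + (q^2 + q)\<close>, that
    is \<open>4 * q^2 - q + 1\<close>.\<close>
  then show ?thesis
    using card_unip card_invol card_nonsplit card_split card_nilpotents card_involutions card_reflections
    by linarith
qed

end

theorem theorem3p8:
  fixes p :: nat
  assumes "prime p" and "odd p"
    and "CARD('a::{field, finite}) = 3 ^ p"
  shows "real (card (Solv (PSL2 :: ('a ^ 2 ^ 2) set monoid)))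
           = (4 * (3 ^ p)\<^sup>2 - 3 ^ p + 1) / 2"
proof -
  interpret char3_field "TYPE('a)"
    using assms by (rule char3_field_if_card)
  have "2 * card (Solv (PSL2 :: ('a ^ 2 ^ 2) set monoid)) + 3 ^ p = 4 * (3 ^ p * 3 ^ p) + 1"
    using card_Solv_PSL2 unfolding assms(3) .
  then have "2 * real (card (Solv (PSL2 :: ('a ^ 2 ^ 2) set monoid))) + 3 ^ p = 4 * (3 ^ p * 3 ^ p) + 1"
    by (metis (mono_tags, lifting) of_nat_add of_nat_mult of_nat_numeral of_nat_power of_nat_1)
  then show ?thesis
    by (simp add: power2_eq_square)
qed

end
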